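(* Let $\mathfrak{B}\subseteq[0,1]$ be a fractal microstructure, let $\beta>0$ be a constant, $F\in L^2(0,1)$ and $f\in\ell^2(\mathfrak{B})$. The problem: find $p\in V_{\mathfrak{B}}$ such that $$\int_0^1 p'\,q' + \beta\sum_{b\in\mathfrak{B}}p(b)\,q(b)=\int_0^1 F\,q+\sum_{b\in\mathfrak{B}}f(b)\,q(b)\qquad\text{for all } q\in V_{\mathfrak{B}},$$ is well-posed.
   Context: Fractal microstructure: a countable set $\mathfrak{B}\subseteq[0,1]$ for which there exist a sequence of finite subsets $\{\mathfrak{B}_n:n\ge 0\}$ and finitely many similarities $S_1,\dots,S_L:[0,1]\to[0,1]$, $L\ge 2$ (each satisfying $|S_i(x)-S_i(y)|=c_i|x-y|$ for all $x,y$, with $c_i\in[0,1)$), such that $\mathfrak{B}_n=\bigcup_{i=1}^L S_i(\mathfrak{B}_{n-1})$ for all $n\ge1$, and $\mathfrak{B}_n$ is monotonically increasing in $n$ with $\bigcup_n\mathfrak{B}_n=\mathfrak{B}$. $\ell^2(\mathfrak{B})=\{g:\mathfrak{B}\to\mathbb{R} : \sum_{b\in\mathfrak{B}}|g(b)|^2<\infty\}$ with its natural Hilbert norm. $V_{\mathfrak{B}}=\{u\in H^1(0,1): u(0)=0,\ \sum_{b\in\mathfrak{B}}|u(b)|^2<\infty\}$, a Hilbert space with inner product $\langle u,v\rangle_{V_{\mathfrak{B}}}=\int_0^1u'v'+\sum_{b\in\mathfrak{B}}u(b)v(b)$; $u'$ is the weak derivative, and elements of $H^1(0,1)$ are identified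 with their continuous representatives on $[0,1]$. Well-posed (Hadamard sense): for all data $F\in L^2(0,1)$, $f\in\ell^2(\mathfrak{B})$ there is exactly one solution, and it depends continuously on the data. *)

theory Defs
  imports "HOL-Analysis.Analysis"
begin

definition fractal_microstructure :: "real set \<Rightarrow> bool" where
  "fractal_microstructure B \<longleftrightarrow>
     countable B \<and> B \<subseteq> {0..1} \<and>
     (\<exists>(Bn :: nat \<Rightarrow> real set) (L :: nat) (S :: nat \<Rightarrow> real \<Rightarrow> real) (c :: nat \<Rightarrow> real).
        2 \<le> L \<and>
        (\<forall>i\<in>{1..L}. S i ` {0..1} \<subseteq> {0..1} \<and> c i \<in> {0..<1} \<and>
           (\<forall>x\<in>{0..1}. \<forall>y\<in>{0..1}. \<bar>S i x - S i y\<bar> = c i * \<bar>x - y\<bar>)) \<and>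
        (\<forall>n. finite (Bn n) \<and> Bn n \<subseteq> B) \<and>
        (\<forall>n\<ge>1. Bn n = (\<Union>i\<in>{1..L}. S i ` Bn (n - 1))) \<and>
        incseq Bn \<and>
        (\<Union>n. Bn n) = B)"

abbreviation leb01 :: "real measure" where
  "leb01 \<equiv> lebesgue_on {0<..<1}"

text \<open>Elements of \<open>L2_01\<close> are functions rather than classes modulo null sets, so
  \<open>L2_norm\<close> is only a seminorm.\<close>

definition L2_01 :: "(real \<Rightarrow> real) set" where
  "L2_01 = {F. F \<in> borel_measurable leb01 \<and> integrable leb01 (\<lambda>x. (F x)\<^sup>2)}"

definition L2_norm :: "(real \<Rightarrow> real) \<Rightarrow> real" where
  "L2_norm F = sqrt (\<integral>x. (F x)\<^sup>2 \<partial>leb01)"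

text \<open>Likewise, only the values on \<open>B\<close> of an element of \<open>ell2 B\<close> matter.\<close>

definition ell2 :: "real set \<Rightarrow> (real \<Rightarrow> real) set" where
  "ell2 B = {g. (\<lambda>b. \<bar>g b\<bar>\<^sup>2) summable_on B}"

definition ell2_norm :: "real set \<Rightarrow> (real \<Rightarrow> real) \<Rightarrow> real" where
  "ell2_norm B g = sqrt (\<Sum>\<^sub>\<infinity>b\<in>B. \<bar>g b\<bar>\<^sup>2)"

text \<open>The test functions \<open>C\<close>-infinity with compact support in \<open>(0,1)\<close>, extended by zero.\<close>

definition test_functions :: "(real \<Rightarrow> real) set" where
  "test_functions = {\<phi>. (\<forall>n x. (deriv ^^ n) \<phi> differentiable (at x)) \<and>
     compact (closure {x. \<phi> x \<noteq> 0}) \<and> closure {x. \<phi> x \<noteq> 0} \<subseteq> {0<..<1}}"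

definition has_weak_deriv :: "(real \<Rightarrow> real) \<Rightarrow> (real \<Rightarrow> real) \<Rightarrow> bool" where
  "has_weak_deriv u v \<longleftrightarrow>
     (\<forall>\<phi>\<in>test_functions. (\<integral>x. u x * deriv \<phi> x \<partial>leb01) = - (\<integral>x. v x * \<phi> x \<partial>leb01))"

text \<open>Elements of \<open>H1_01\<close> are the continuous representatives on \<open>[0,1]\<close>; they are set to zero
  off \<open>[0,1]\<close> so that equality of HOL functions is equality on \<open>[0,1]\<close>.\<close>

definition H1_01 :: "(real \<Rightarrow> real) set" where
  "H1_01 = {u. continuous_on {0..1} u \<and> (\<forall>x. x \<notin> {0..1} \<longrightarrow> u x = 0) \<and>
     u \<in> L2_01 \<and> (\<exists>v\<in>L2_01. has_weak_deriv u v)}"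

text \<open>Some version of the weak derivative, which is unique up to null sets.\<close>

definition weak_deriv :: "(real \<Rightarrow> real) \<Rightarrow> real \<Rightarrow> real" where
  "weak_deriv u = (SOME v. v \<in> L2_01 \<and> has_weak_deriv u v)"

definition V_space :: "real set \<Rightarrow> (real \<Rightarrow> real) set" where
  "V_space B = {u \<in> H1_01. u 0 = 0 \<and> (\<lambda>b. \<bar>u b\<bar>\<^sup>2) summable_on B}"

definition V_inner :: "real set \<Rightarrow> (real \<Rightarrow> real) \<Rightarrow> (real \<Rightarrow> real) \<Rightarrow> real" where
  "V_inner B u v =
     (\<integral>x. weak_deriv u x * weak_deriv v x \<partial>leb01) + (\<Sum>\<^sub>\<infinity>b\<in>B. u b * v b)"

definition V_norm :: "real set \<Rightarrow> (real \<Rightarrow> real) \<Rightarrow> real" where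
  "V_norm B u = sqrt (V_inner B u u)"

text \<open>Well-posedness in the sense of Hadamard of a problem with data in \<open>D\<close> and solutions sought
  in \<open>X\<close>, where \<open>dD\<close> and \<open>dX\<close> are the distances on \<open>D\<close> and \<open>X\<close>.\<close>

definition well_posed ::
    "'d set \<Rightarrow> ('d \<Rightarrow> 'd \<Rightarrow> real) \<Rightarrow> 'u set \<Rightarrow> ('u \<Rightarrow> 'u \<Rightarrow> real) \<Rightarrow> ('d \<Rightarrow> 'u \<Rightarrow> bool) \<Rightarrow> bool" where
  "well_posed D dD X dX sol \<longleftrightarrow>
     (\<forall>d\<in>D. \<exists>!u. u \<in> X \<and> sol d u) \<and>
     (\<forall>d\<in>D. \<forall>u\<in>X. sol d u \<longrightarrow>
        (\<forall>\<epsilon>>0. \<exists>\<delta>>0. \<forall>d'\<in>D. \<forall>u'\<in>X. sol d' u' \<and> dD d' d < \<delta> \<longrightarrow> dX u' u < \<epsilon>))"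

definition data_dist ::
    "real set \<Rightarrow> (real \<Rightarrow> real) \<times> (real \<Rightarrow> real) \<Rightarrow> (real \<Rightarrow> real) \<times> (real \<Rightarrow> real) \<Rightarrow> real" where
  "data_dist B = (\<lambda>(F, f) (G, g).
     sqrt ((L2_norm (\<lambda>x. F x - G x))\<^sup>2 + (ell2_norm B (\<lambda>b. f b - g b))\<^sup>2))"

definition V_dist :: "real set \<Rightarrow> (real \<Rightarrow> real) \<Rightarrow> (real \<Rightarrow> real) \<Rightarrow> real" where
  "V_dist B u v = V_norm B (\<lambda>x. u x - v x)"

end

theory Submission
  imports Defs
begin

text \<open>
  The problem is the Euler equation of a coercive symmetric form on a Hilbert space, so it is
  solved by the Riesz representation theorem.  Write
  \<open>a(u,v) = \<integral>u'v' + \<beta> \<Sum>u(b)v(b)\<close> for the form (\<open>energy\<close> below) and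
  \<open>l(q) = \<integral>Fq + \<Sum>f(b)q(b)\<close> for the right-hand side (\<open>load\<close>).

  Since \<open>min 1 \<beta> * \<parallel>q\<parallel>\<^sup>2 \<le> a(q,q)\<close> (\<open>energy_coercive\<close>), \<open>a\<close> is an inner product equivalent
  to the one of \<open>V\<close>.  An element of \<open>V\<close> vanishes at \<open>0\<close>, so it is bounded by the \<open>L\<^sup>2\<close> norm of its
  derivative (\<open>poincare\<close>), and \<open>l\<close> is bounded with norm at most the norm of the data (\<open>load_bound\<close>).
  Existence is then \<open>riesz_representation\<close>.  For two solutions, testing the difference \<open>e\<close> of the
  two equations with \<open>e\<close> itself gives \<open>min 1 \<beta> * \<parallel>e\<parallel>\<^sup>2 \<le> a(e,e) \<le> \<parallel>difference of data\<parallel> * \<parallel>e\<parallel>\<close>;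
  this Lipschitz estimate (\<open>stability\<close>) contains both uniqueness and continuous dependence.

  The analytic work is the completeness of \<open>V\<close> (\<open>energy_complete\<close>).  It rests on the fact that
  \<open>v \<mapsto> \<integral>\<^sub>0\<^sup>x v\<close> is, up to null sets, a linear bijection from \<open>L\<^sup>2\<close> onto the \<open>H\<^sup>1\<close> functions vanishing
  at \<open>0\<close>, with the weak derivative as inverse.  That primitives have the expected weak derivative is
  Fubini's theorem (\<open>primitive_has_weak_deriv\<close>); that there are no other functions with that weak
  derivative is the lemma of du Bois-Reymond (\<open>du_bois_reymond\<close>), for which smooth bump functions
  have to be produced; that the weak derivative is unique almost everywhere is
  \<open>primitive_eq_0_imp_AE\<close>.  A Cauchy sequence in \<open>V\<close> then has derivatives converging in \<open>L\<^sup>2\<close>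
  (\<open>L2_complete\<close>), hence converges uniformly, and the uniform limit inherits the square summability
  over \<open>B\<close> from finite partial sums.
\<close>

section \<open>Positive semidefinite forms and the Riesz representation theorem\<close>

text \<open>
  The spaces at hand consist of functions, and their forms may be degenerate: they do not see
  values on null sets or off \<open>B\<close>.  Hence the form is only semidefinite, and linearity is phrased
  through pointwise combinations \<open>u + c v\<close>.
\<close>

locale semi_inner =
  fixes X :: "('b \<Rightarrow> real) set" and a :: "('b \<Rightarrow> real) \<Rightarrow> ('b \<Rightarrow> real) \<Rightarrow> real"
  assumes zero: "(\<lambda>x. 0) \<in> X"
    and comb: "\<And>u v c. u \<in> X \<Longrightarrow> v \<in> X \<Longrightarrow> (\<lambda>x. u x + c * v x) \<in> X"
    and sym: "\<And>u v. u \<in> X \<Longrightarrow> v \<in> X \<Longrightarrow> a u v = a v u"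
    and lin: "\<And>u v w c. u \<in> X \<Longrightarrow> v \<in> X \<Longrightarrow> w \<in> X \<Longrightarrow> a (\<lambda>x. u x + c * v x) w = a u w + c * a v w"
    and nonneg: "\<And>u. u \<in> X \<Longrightarrow> 0 \<le> a u u"
begin

lemma scale: "u \<in> X \<Longrightarrow> (\<lambda>x. c * u x) \<in> X"
  using comb[OF zero, of u c] by simp

lemma diff: "u \<in> X \<Longrightarrow> v \<in> X \<Longrightarrow> (\<lambda>x. u x - v x) \<in> X"
  using comb[of u v "-1"] by simp

lemma diff_left: "u \<in> X \<Longrightarrow> v \<in> X \<Longrightarrow> w \<in> X \<Longrightarrow> a (\<lambda>x. u x - v x) w = a u w - a v w"
  using lin[of u v w "-1"] by simp

lemma square_comb:
  assumes "u \<in> X" "v \<in> X"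
  shows "a (\<lambda>x. u x + c * v x) (\<lambda>x. u x + c * v x) = a u u + 2 * c * a u v + c\<^sup>2 * a v v"
  using assms by (simp add: lin comb sym[of _ "\<lambda>x. u x + c * v x"] sym[of v u] power2_eq_square algebra_simps)

lemma square_diff:
  assumes "u \<in> X" "v \<in> X"
  shows "a (\<lambda>x. u x - v x) (\<lambda>x. u x - v x) = a u u - 2 * a u v + a v v"
  using square_comb[OF assms, of "-1"] by simp

end

text \<open>
  A real quadratic that never becomes negative has nonpositive discriminant.  The degenerate case
  \<open>p = 0\<close> is included because the forms to which it is applied may vanish on nonzero functions.
\<close>
lemma discriminant_bound:
  fixes p q r :: real
  assumes "\<And>t. 0 \<le> r + 2 * t * q + t\<^sup>2 * p" and "0 \<le> p"
  shows "q\<^sup>2 \<le> p * r"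
proof (cases "p = 0")
  case True
  have "q = 0"
  proof (rule ccontr)
    assume "q \<noteq> 0"
    then show False using assms(1)[of "- (r + 1) / (2 * q)"] True by (simp add: field_simps)
  qed
  then show ?thesis using True by simp
next
  case False
  have "0 \<le> (r + 2 * (- q / p) * q + (- q / p)\<^sup>2 * p) * p"
    using assms by (intro mult_nonneg_nonneg)
  also have "\<dots> = p * r - q\<^sup>2" using False by (simp add: field_simps power2_eq_square)
  finally show ?thesis by simp
qed

context semi_inner
begin

lemma cauchy_schwarz:
  assumes "u \<in> X" "v \<in> X"
  shows "(a u v)\<^sup>2 \<le> a u u * a v v"
proof -
  have "0 \<le> a u u + 2 * t * a u v + t\<^sup>2 * a v v" for t
    using nonneg[OF comb[OF assms, of t]] by (simp add: square_comb[OF assms])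
  from discriminant_bound[OF this] show ?thesis using assms nonneg by (simp add: mult.commute)
qed

lemma cauchy_schwarz_sqrt:
  assumes "u \<in> X" "v \<in> X"
  shows "\<bar>a u v\<bar> \<le> sqrt (a u u) * sqrt (a v v)"
  using real_sqrt_le_mono[OF cauchy_schwarz[OF assms]] by (simp add: real_sqrt_mult)

text \<open>
  The classical variational proof: a sequence \<open>s\<close> minimising the quadratic functional
  \<open>J u = a u u - 2 * l u\<close> is Cauchy by the parallelogram law, and its limit represents \<open>l\<close>.
  The limit is identified through the near-minimality of each \<open>s n\<close>: comparing \<open>J (s n)\<close> with
  \<open>J (s n + t v)\<close> for all \<open>t\<close> bounds \<open>a (s n) v - l v\<close> by a discriminant, so that the minimality of
  the limit itself does not have to be discussed.
\<close>
theorem riesz_representation: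
  assumes complete: "\<And>s :: nat \<Rightarrow> 'b \<Rightarrow> real.
      (\<And>n. s n \<in> X) \<Longrightarrow>
      (\<And>e. 0 < e \<Longrightarrow> \<exists>N. \<forall>m\<ge>N. \<forall>n\<ge>N. a (\<lambda>x. s m x - s n x) (\<lambda>x. s m x - s n x) < e) \<Longrightarrow>
      \<exists>u\<in>X. (\<lambda>n. a (\<lambda>x. s n x - u x) (\<lambda>x. s n x - u x)) \<longlonglongrightarrow> 0"
    and l_lin: "\<And>u v c. u \<in> X \<Longrightarrow> v \<in> X \<Longrightarrow> l (\<lambda>x. u x + c * v x) = l u + c * l v"
    and l_bound: "\<And>u. u \<in> X \<Longrightarrow> \<bar>l u\<bar> \<le> C * sqrt (a u u)"
  shows "\<exists>u\<in>X. \<forall>v\<in>X. a u v = l v"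
proof -
  define J where "J u = a u u - 2 * l u" for u
  have J_lower: "- C\<^sup>2 \<le> J u" if "u \<in> X" for u
  proof -
    have "0 \<le> (sqrt (a u u) - C)\<^sup>2" by simp
    also have "\<dots> = a u u - 2 * (C * sqrt (a u u)) + C\<^sup>2"
      using nonneg[OF that] by (simp add: power2_diff)
    also have "\<dots> \<le> J u + C\<^sup>2" using l_bound[OF that] by (simp add: J_def)
    finally show ?thesis by simp
  qed
  define m where "m = (INF u\<in>X. J u)"
  have bdd: "bdd_below (J ` X)" using J_lower by (meson bdd_below.I2)
  have m_le: "m \<le> J u" if "u \<in> X" for u
    unfolding m_def using bdd that by (rule cINF_lower)
  have "\<exists>u\<in>X. J u < m + 1 / real (Suc n)" for n
  proof -
    have "m < m + 1 / real (Suc n)" by simp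
    then show ?thesis unfolding m_def using cINF_less_iff[OF _ bdd] zero by blast
  qed
  then obtain s where sX: "\<And>n. s n \<in> X" and sJ: "\<And>n. J (s n) < m + 1 / real (Suc n)" by metis
  \<comment> \<open>Parallelogram law: the midpoint of two near-minimisers has \<open>J\<close> value at least \<open>m\<close>.\<close>
  have near: "a (\<lambda>x. s i x - s j x) (\<lambda>x. s i x - s j x) \<le> 2 / real (Suc i) + 2 / real (Suc j)" for i j
  proof -
    have mid: "(\<lambda>x. 1/2 * (s i x + 1 * s j x)) \<in> X" using sX by (intro scale comb)
    have half: "a (\<lambda>x. 1/2 * w x) (\<lambda>x. 1/2 * w x) = 1/4 * a w w" "l (\<lambda>x. 1/2 * w x) = 1/2 * l w"
      if "w \<in> X" for w
    proof -
      have z: "a (\<lambda>x. 0) w = 0" if "w \<in> X" for w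
        using lin[OF zero zero that, of 1] by simp
      show "a (\<lambda>x. 1/2 * w x) (\<lambda>x. 1/2 * w x) = 1/4 * a w w"
        using square_comb[OF zero that, of "1/2"] z[OF zero] z[OF that] by (simp add: power2_eq_square)
      have "l (\<lambda>x. 0) = 0" using l_lin[OF zero zero, of 1] by simp
      then show "l (\<lambda>x. 1/2 * w x) = 1/2 * l w" using l_lin[OF zero that, of "1/2"] by simp
    qed
    have "a (\<lambda>x. s i x - s j x) (\<lambda>x. s i x - s j x)
        = 2 * J (s i) + 2 * J (s j) - 4 * J (\<lambda>x. 1/2 * (s i x + 1 * s j x))"
      using half[OF comb[OF sX sX, of i 1 j]] square_comb[OF sX sX, of i 1 j] square_diff[OF sX sX, of i j]
        l_lin[OF sX sX, of i 1 j]
      by (simp add: J_def)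
    also have "\<dots> \<le> 2 / real (Suc i) + 2 / real (Suc j)"
      using sJ[of i] sJ[of j] m_le[OF mid] by linarith
    finally show ?thesis .
  qed
  have "\<exists>N. \<forall>i\<ge>N. \<forall>j\<ge>N. a (\<lambda>x. s i x - s j x) (\<lambda>x. s i x - s j x) < e" if "0 < e" for e
  proof -
    have "0 < e / 4" using that by simp
    then obtain N where N: "1 / real (Suc N) < e / 4"
      using reals_Archimedean unfolding inverse_eq_divide by blast
    have le: "1 / real (Suc i) \<le> 1 / real (Suc N)" if "i \<ge> N" for i
      using that by (simp add: frac_le)
    show ?thesis
    proof (intro exI allI impI)
      fix i j assume "N \<le> i" "N \<le> j"
      then show "a (\<lambda>x. s i x - s j x) (\<lambda>x. s i x - s j x) < e"
        using near[of i j] le[of i] le[of j] N by simp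
    qed
  qed
  from complete[OF sX this] obtain u where u: "u \<in> X"
    and lim: "(\<lambda>n. a (\<lambda>x. s n x - u x) (\<lambda>x. s n x - u x)) \<longlonglongrightarrow> 0" by blast
  have "a u v = l v" if v: "v \<in> X" for v
  proof -
    have approx: "(a (s n) v - l v)\<^sup>2 \<le> a v v * (1 / real (Suc n))" for n
    proof (rule discriminant_bound)
      fix t
      have "m \<le> J (\<lambda>x. s n x + t * v x)" by (intro m_le comb sX v)
      also have "\<dots> = J (s n) + 2 * t * (a (s n) v - l v) + t\<^sup>2 * a v v"
        using square_comb[OF sX v] l_lin[OF sX v] by (simp add: J_def algebra_simps)
      finally show "0 \<le> 1 / real (Suc n) + 2 * t * (a (s n) v - l v) + t\<^sup>2 * a v v"
        using sJ[of n] by linarith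
    qed (use v nonneg in auto)
    have "(\<lambda>n. (a (s n) v - l v)\<^sup>2) \<longlonglongrightarrow> 0"
    proof (rule tendsto_sandwich[where f = "\<lambda>_. 0"])
      show "(\<lambda>n. a v v * (1 / real (Suc n))) \<longlonglongrightarrow> 0"
        using tendsto_mult_left[OF LIMSEQ_inverse_real_of_nat, of "a v v"] by (simp add: inverse_eq_divide)
    qed (use approx in auto)
    then have 1: "(\<lambda>n. a (s n) v - l v) \<longlonglongrightarrow> 0" by simp
    have "(\<lambda>n. (a (s n) v - a u v)\<^sup>2) \<longlonglongrightarrow> 0"
    proof (rule tendsto_sandwich[where f = "\<lambda>_. 0"])
      show "(\<lambda>n. a (\<lambda>x. s n x - u x) (\<lambda>x. s n x - u x) * a v v) \<longlonglongrightarrow> 0"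
        using tendsto_mult_right[OF lim, of "a v v"] by simp
      show "\<forall>\<^sub>F n in sequentially. (a (s n) v - a u v)\<^sup>2 \<le> a (\<lambda>x. s n x - u x) (\<lambda>x. s n x - u x) * a v v"
        using cauchy_schwarz[OF diff[OF sX u] v] diff_left[OF sX u v] by simp
    qed auto
    then have 2: "(\<lambda>n. a (s n) v - a u v) \<longlonglongrightarrow> 0" by simp
    show ?thesis using LIMSEQ_unique[OF _ tendsto_diff[OF 1 2], of "a u v - l v"] by simp
  qed
  then show ?thesis using u by blast
qed

end

section \<open>Square integrable functions and their completeness\<close>

definition square_integrable :: "'a measure \<Rightarrow> ('a \<Rightarrow> real) set" where
  "square_integrable M = {f \<in> borel_measurable M. integrable M (\<lambda>x. (f x)\<^sup>2)}"

lemma square_integrable_measurable [measurable_dest]: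
  "f \<in> square_integrable M \<Longrightarrow> f \<in> borel_measurable M"
  by (simp add: square_integrable_def)

lemma square_integrable_power2: "f \<in> square_integrable M \<Longrightarrow> integrable M (\<lambda>x. (f x)\<^sup>2)"
  by (simp add: square_integrable_def)

lemma abs_mult_le_squares: "\<bar>x * y\<bar> \<le> x\<^sup>2 + y\<^sup>2" for x y :: real
proof -
  have "0 \<le> (\<bar>x\<bar> - \<bar>y\<bar>)\<^sup>2" by simp
  then have "2 * \<bar>x * y\<bar> \<le> x\<^sup>2 + y\<^sup>2" by (simp add: power2_diff abs_mult)
  then show ?thesis by linarith
qed

lemma integrable_mult_square_integrable:
  assumes f: "f \<in> square_integrable M" and g: "g \<in> square_integrable M"
  shows "integrable M (\<lambda>x. f x * g x)"
proof (rule Bochner_Integration.integrable_bound)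
  show "integrable M (\<lambda>x. (f x)\<^sup>2 + (g x)\<^sup>2)"
    using f g by (simp add: square_integrable_power2)
  show "(\<lambda>x. f x * g x) \<in> borel_measurable M" using f g by measurable
  show "AE x in M. norm (f x * g x) \<le> norm ((f x)\<^sup>2 + (g x)\<^sup>2)"
    using abs_mult_le_squares by simp
qed

lemma square_integrable_comb:
  assumes f: "f \<in> square_integrable M" and g: "g \<in> square_integrable M"
  shows "(\<lambda>x. f x + c * g x) \<in> square_integrable M"
proof -
  have "integrable M (\<lambda>x. (f x)\<^sup>2 + (2 * c) * (f x * g x) + c\<^sup>2 * (g x)\<^sup>2)"
    using f g by (simp add: square_integrable_power2 integrable_mult_square_integrable)
  also have "(\<lambda>x. (f x)\<^sup>2 + (2 * c) * (f x * g x) + c\<^sup>2 * (g x)\<^sup>2) = (\<lambda>x. (f x + c * g x)\<^sup>2)"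
    by (auto simp: power2_eq_square algebra_simps)
  finally have "integrable M (\<lambda>x. (f x + c * g x)\<^sup>2)" .
  moreover have "(\<lambda>x. f x + c * g x) \<in> borel_measurable M" using f g by measurable
  ultimately show ?thesis by (simp add: square_integrable_def)
qed

lemma semi_inner_L2: "semi_inner (square_integrable M) (\<lambda>f g. \<integral>x. f x * g x \<partial>M)"
proof
  show "(\<lambda>x. 0) \<in> square_integrable M" by (simp add: square_integrable_def)
  fix u v w :: "'a \<Rightarrow> real" and c
  assume u: "u \<in> square_integrable M"
  show "0 \<le> (\<integral>x. u x * u x \<partial>M)" by simp
  assume v: "v \<in> square_integrable M"
  show "(\<lambda>x. u x + c * v x) \<in> square_integrable M" using u v by (rule square_integrable_comb)
  show "(\<integral>x. u x * v x \<partial>M) = (\<integral>x. v x * u x \<partial>M)" by (simp add: mult.commute)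
  assume w: "w \<in> square_integrable M"
  show "(\<integral>x. (u x + c * v x) * w x \<partial>M) = (\<integral>x. u x * w x \<partial>M) + c * (\<integral>x. v x * w x \<partial>M)"
    using integrable_mult_square_integrable[OF u w] integrable_mult_square_integrable[OF v w]
    by (simp add: distrib_right mult.assoc)
qed

text \<open>
  Split \<open>d k\<close> as the product of \<open>2 powr (- k / 2)\<close> and \<open>2 powr (k / 2) * d k\<close>; both factors are
  square summable.
\<close>
lemma summable_of_weighted_squares:
  fixes d :: "nat \<Rightarrow> real"
  assumes "summable (\<lambda>k. 2 ^ k * (d k)\<^sup>2)"
  shows "summable d"
proof (rule summable_comparison_test')
  show "summable (\<lambda>k. (1/2) ^ k + 2 ^ k * (d k)\<^sup>2)"
    by (intro summable_add assms summable_geometric) simp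
  show "norm (d k) \<le> (1/2) ^ k + 2 ^ k * (d k)\<^sup>2" for k
  proof -
    have "\<bar>sqrt ((1/2)^k) * (sqrt (2^k) * d k)\<bar> \<le> (sqrt ((1/2)^k))\<^sup>2 + (sqrt (2^k) * d k)\<^sup>2"
      by (rule abs_mult_le_squares)
    moreover have "sqrt ((1/2)^k) * (sqrt (2^k) * d k) = d k"
      by (simp add: power_one_over real_sqrt_divide)
    ultimately show ?thesis by (simp add: power_mult_distrib)
  qed
qed

text \<open>
  Riesz--Fischer.  Along a subsequence with steps \<open>d k\<close> of squared norm below \<open>4\<^sup>-\<^sup>k\<close>, the function
  \<open>\<Sum>k. 2\<^sup>k * (d k)\<^sup>2\<close> has finite integral and hence is finite almost everywhere; there the
  subsequence converges pointwise.  Fatou's lemma upgrades this to convergence in mean of the whole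
  sequence.
\<close>
theorem L2_complete:
  fixes f :: "nat \<Rightarrow> 'a \<Rightarrow> real"
  assumes f: "\<And>n. f n \<in> square_integrable M"
    and Cauchy: "\<And>e. 0 < e \<Longrightarrow> \<exists>N. \<forall>m\<ge>N. \<forall>n\<ge>N. (\<integral>x. (f m x - f n x)\<^sup>2 \<partial>M) < e"
  shows "\<exists>g\<in>square_integrable M. (\<lambda>n. \<integral>x. (f n x - g x)\<^sup>2 \<partial>M) \<longlonglongrightarrow> 0"
proof -
  note [measurable] = square_integrable_measurable[OF f]
  interpret L2: semi_inner "square_integrable M" "\<lambda>f g. \<integral>x. f x * g x \<partial>M" by (rule semi_inner_L2)
  have int: "integrable M (\<lambda>x. (f m x - f n x)\<^sup>2)" for m n
    using L2.diff[OF f f] by (rule square_integrable_power2)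
  have "\<exists>N. \<forall>m\<ge>N. \<forall>n\<ge>N. (\<integral>x. (f m x - f n x)\<^sup>2 \<partial>M) < (1/4)^k" for k
    by (rule Cauchy) simp
  then obtain N where N: "\<And>k m n. N k \<le> m \<Longrightarrow> N k \<le> n \<Longrightarrow> (\<integral>x. (f m x - f n x)\<^sup>2 \<partial>M) < (1/4)^k"
    by metis
  \<comment> \<open>The partial sums make the indices monotone while still dominating \<open>N\<close> and the identity.\<close>
  define r where "r k = (\<Sum>i\<le>k. N i) + k" for k
  have r_mono: "r k \<le> r (Suc k)" for k by (simp add: r_def)
  have r_ge: "N k \<le> r k" for k using member_le_sum[of k "{..k}" N] by (simp add: r_def)
  have r_ge': "k \<le> r k" for k by (simp add: r_def)
  define d where "d k x = f (r (Suc k)) x - f (r k) x" for k x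
  have [measurable]: "d k \<in> borel_measurable M" for k unfolding d_def by measurable
  have "(\<integral>\<^sup>+x. ennreal (2^k * (d k x)\<^sup>2) \<partial>M) \<le> ennreal ((1/2)^k)" for k
  proof -
    have "(\<integral>\<^sup>+x. ennreal (2^k * (d k x)\<^sup>2) \<partial>M) = ennreal (\<integral>x. 2^k * (d k x)\<^sup>2 \<partial>M)"
      unfolding d_def by (intro nn_integral_eq_integral) (auto intro: int)
    also have "\<dots> \<le> ennreal (2^k * (1/4)^k)"
      using N[of k "r (Suc k)" "r k"] r_ge r_mono[of k] order_trans[OF r_ge r_mono]
      by (intro ennreal_leI) (simp add: d_def)
    finally show ?thesis by (simp add: power_mult_distrib[symmetric])
  qed
  then have "(\<integral>\<^sup>+x. (\<Sum>k. ennreal (2^k * (d k x)\<^sup>2)) \<partial>M) \<le> (\<Sum>k. ennreal ((1/2)^k))"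
    by (subst nn_integral_suminf) (auto intro!: suminf_le)
  also have "\<dots> = ennreal (\<Sum>k. (1/2)^k)"
    by (intro suminf_ennreal2) auto
  finally have "(\<integral>\<^sup>+x. (\<Sum>k. ennreal (2^k * (d k x)\<^sup>2)) \<partial>M) \<noteq> \<infinity>"
    using ennreal_less_top leD by (metis infinity_ennreal_def)
  then have "AE x in M. (\<Sum>k. ennreal (2^k * (d k x)\<^sup>2)) \<noteq> \<infinity>"
    by (intro nn_integral_PInf_AE) auto
  then have "AE x in M. convergent (\<lambda>k. f (r k) x)"
  proof eventually_elim
    case (elim x)
    then have "summable (\<lambda>k. 2^k * (d k x)\<^sup>2)"
      by (intro summable_suminf_not_top) (auto simp: top_ennreal_def)
    then have "summable (\<lambda>k. d k x)" by (rule summable_of_weighted_squares)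
    then have "convergent (\<lambda>n. \<Sum>k<n. d k x)" by (simp add: summable_iff_convergent)
    moreover have "(\<Sum>k<n. d k x) = f (r n) x - f (r 0) x" for n
      unfolding d_def by (rule sum_lessThan_telescope)
    ultimately have "convergent (\<lambda>n. f (r n) x - f (r 0) x)" by simp
    from convergent_add[OF this convergent_const[of "f (r 0) x"]] show ?case by simp
  qed
  define g where "g x = lim (\<lambda>k. f (r k) x)" for x
  have [measurable]: "g \<in> borel_measurable M" unfolding g_def by measurable
  have lim: "AE x in M. (\<lambda>k. f (r k) x) \<longlonglongrightarrow> g x"
    using \<open>AE x in M. convergent _\<close> by eventually_elim (simp add: g_def convergent_LIMSEQ_iff)
  \<comment> \<open>Fatou along the subsequence: what holds for all late \<open>f m\<close> passes to the limit \<open>g\<close>.\<close>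
  have bound: "(\<integral>\<^sup>+x. ennreal ((f n x - g x)\<^sup>2) \<partial>M) \<le> ennreal e"
    if n: "\<And>m. m \<ge> n \<Longrightarrow> (\<integral>x. (f n x - f m x)\<^sup>2 \<partial>M) < e" for n e
  proof -
    have "(\<integral>\<^sup>+x. ennreal ((f n x - g x)\<^sup>2) \<partial>M)
        \<le> (\<integral>\<^sup>+x. liminf (\<lambda>k. ennreal ((f n x - f (r k) x)\<^sup>2)) \<partial>M)"
    proof (rule nn_integral_mono_AE, use lim in eventually_elim)
      case (elim x)
      then have "(\<lambda>k. ennreal ((f n x - f (r k) x)\<^sup>2)) \<longlonglongrightarrow> ennreal ((f n x - g x)\<^sup>2)"
        by (intro tendsto_intros)
      from lim_imp_Liminf[OF _ this] show ?case by simp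
    qed
    also have "\<dots> \<le> liminf (\<lambda>k. \<integral>\<^sup>+x. ennreal ((f n x - f (r k) x)\<^sup>2) \<partial>M)"
      by (rule nn_integral_liminf) auto
    also have "\<dots> \<le> limsup (\<lambda>k. \<integral>\<^sup>+x. ennreal ((f n x - f (r k) x)\<^sup>2) \<partial>M)"
      by (rule Liminf_le_Limsup) simp
    also have "\<dots> \<le> ennreal e"
    proof (rule Limsup_bounded)
      show "\<forall>\<^sub>F k in sequentially. (\<integral>\<^sup>+x. ennreal ((f n x - f (r k) x)\<^sup>2) \<partial>M) \<le> ennreal e"
        using eventually_ge_at_top[of n]
      proof eventually_elim
        case (elim k)
        then show ?case
          using n[of "r k"] r_ge'[of k]
          by (subst nn_integral_eq_integral) (auto intro!: int ennreal_leI)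
      qed
    qed
    finally show ?thesis .
  qed
  have int_g: "integrable M (\<lambda>x. (f n x - g x)\<^sup>2)" and le_g: "(\<integral>x. (f n x - g x)\<^sup>2 \<partial>M) \<le> e"
    if n: "\<And>m. m \<ge> n \<Longrightarrow> (\<integral>x. (f n x - f m x)\<^sup>2 \<partial>M) < e" for n e
  proof -
    have "(\<integral>\<^sup>+x. ennreal ((f n x - g x)\<^sup>2) \<partial>M) < \<infinity>"
      using bound[OF n] by (simp add: le_less_trans)
    then show i: "integrable M (\<lambda>x. (f n x - g x)\<^sup>2)" by (intro integrableI_nonneg) auto
    have "0 \<le> e" using n[of n] by simp
    then show "(\<integral>x. (f n x - g x)\<^sup>2 \<partial>M) \<le> e"
      using bound[OF n] nn_integral_eq_integral[OF i] by simp
  qed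
  obtain K where K: "\<And>m. m \<ge> K \<Longrightarrow> (\<integral>x. (f K x - f m x)\<^sup>2 \<partial>M) < 1"
    using Cauchy[of 1] by auto
  have "(\<lambda>x. f K x - g x) \<in> square_integrable M" using int_g[OF K] by (simp add: square_integrable_def)
  from L2.diff[OF f this, of K] have "g \<in> square_integrable M" by simp
  moreover have "(\<lambda>n. \<integral>x. (f n x - g x)\<^sup>2 \<partial>M) \<longlonglongrightarrow> 0"
  proof (rule LIMSEQ_I)
    fix e :: real assume "0 < e"
    then obtain L where L: "\<And>m n. m \<ge> L \<Longrightarrow> n \<ge> L \<Longrightarrow> (\<integral>x. (f m x - f n x)\<^sup>2 \<partial>M) < e / 2"
      using Cauchy[of "e/2"] by auto
    have "norm ((\<integral>x. (f n x - g x)\<^sup>2 \<partial>M) - 0) < e" if "n \<ge> L" for n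
    proof -
      have "(\<integral>x. (f n x - g x)\<^sup>2 \<partial>M) \<le> e / 2" using L that by (intro le_g) auto
      then show ?thesis using \<open>0 < e\<close> by simp
    qed
    then show "\<exists>L. \<forall>n\<ge>L. norm ((\<integral>x. (f n x - g x)\<^sup>2 \<partial>M) - 0) < e" by blast
  qed
  ultimately show ?thesis by blast
qed

section \<open>Smooth bump functions and the lemma of du Bois-Reymond\<close>

text \<open>
  For \<open>P = 1\<close> this is the standard smooth function that is flat at \<open>0\<close>; the polynomial factor in
  \<open>1 / x\<close> makes the family closed under differentiation.
\<close>
definition flat :: "real poly \<Rightarrow> real \<Rightarrow> real" where
  "flat P x = (if 0 < x then poly P (1 / x) * exp (- (1 / x)) else 0)"

lemma poly_over_exp_tendsto_0: "((\<lambda>y. poly P y / exp y) \<longlongrightarrow> (0::real)) at_top"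
proof -
  have "((\<lambda>y. \<Sum>i\<le>degree P. coeff P i * (y ^ i / exp y)) \<longlongrightarrow> (\<Sum>i\<le>degree P. coeff P i * 0)) at_top"
    by (intro tendsto_intros tendsto_power_div_exp_0)
  then show ?thesis by (simp add: poly_altdef sum_divide_distrib)
qed

lemma flat_tendsto_0: "(flat P \<longlongrightarrow> 0) (at 0)"
proof -
  have "((\<lambda>x. poly P (inverse x) / exp (inverse x)) \<longlongrightarrow> 0) (at_right (0::real))"
    using filterlim_compose[OF poly_over_exp_tendsto_0 filterlim_inverse_at_top_right] .
  then have right: "(flat P \<longlongrightarrow> 0) (at_right 0)"
    by (rule Lim_transform_eventually)
      (auto simp: flat_def exp_minus inverse_eq_divide eventually_at_filter)
  have left: "(flat P \<longlongrightarrow> 0) (at_left 0)"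
    by (rule Lim_transform_eventually[OF tendsto_const]) (auto simp: flat_def eventually_at_filter)
  from left right show ?thesis by (rule filterlim_split_at)
qed

text \<open>
  The critical point is \<open>0\<close>: there the difference quotient is again a function of the family, with
  polynomial \<open>X * P\<close>, and every function of the family tends to \<open>0\<close>.
\<close>
lemma flat_has_derivative:
  "(flat P has_real_derivative flat ([:0, 0, 1:] * (P - pderiv P)) x) (at x)"
proof (cases x "0::real" rule: linorder_cases)
  case less
  have "((\<lambda>_. 0) has_real_derivative 0) (at x)" by simp
  then have "(flat P has_real_derivative 0) (at x)"
    by (rule DERIV_cong_ev[OF refl _ refl, THEN iffD1, rotated])
      (use less in \<open>auto simp: flat_def intro!: eventually_mono[OF eventually_nhds_in_open[of "{..<0}" x]]\<close>)
  then show ?thesis using less by (simp add: flat_def)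
next
  case equal
  have "(\<lambda>h. (flat P (x + h) - flat P x) / h) = flat ([:0, 1:] * P)"
    by (auto simp: flat_def equal)
  then show ?thesis
    using flat_tendsto_0[of "[:0, 1:] * P"] equal unfolding DERIV_def by (simp add: flat_def)
next
  case greater
  have "((\<lambda>x. poly P (1 / x) * exp (- (1 / x))) has_real_derivative
      flat ([:0, 0, 1:] * (P - pderiv P)) x) (at x)"
    using greater
    by (auto intro!: derivative_eq_intros DERIV_chain2[OF poly_DERIV] simp: flat_def field_simps power2_eq_square)
  then show ?thesis
    by (rule DERIV_cong_ev[OF refl _ refl, THEN iffD1, rotated])
      (use greater in \<open>auto simp: flat_def intro!: eventually_mono[OF eventually_nhds_in_open[of "{0<..}" x]]\<close>)
qed

text \<open>
  An algebra of functions that is closed under differentiation consists of smooth functions.  This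
  gives smoothness of products of flat functions without a Leibniz formula for higher derivatives.
\<close>
inductive_set flat_algebra :: "(real \<Rightarrow> real) set" where
  const: "(\<lambda>x. c) \<in> flat_algebra"
| flat: "(\<lambda>x. flat P (a + c * x)) \<in> flat_algebra"
| add: "f \<in> flat_algebra \<Longrightarrow> g \<in> flat_algebra \<Longrightarrow> (\<lambda>x. f x + g x) \<in> flat_algebra"
| mult: "f \<in> flat_algebra \<Longrightarrow> g \<in> flat_algebra \<Longrightarrow> (\<lambda>x. f x * g x) \<in> flat_algebra"

lemma flat_algebra_has_derivative:
  "f \<in> flat_algebra \<Longrightarrow> \<exists>f'\<in>flat_algebra. \<forall>x. (f has_real_derivative f' x) (at x)"
proof (induction rule: flat_algebra.induct)
  case (const c)
  show ?case by (rule bexI[OF _ flat_algebra.const[of 0]]) simp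
next
  case (flat P a c)
  show ?case
  proof (rule bexI[OF _ flat_algebra.mult[OF flat_algebra.flat flat_algebra.const]], rule allI)
    fix x
    have "((\<lambda>x. a + c * x) has_real_derivative c) (at x)"
      by (auto intro!: derivative_eq_intros)
    from DERIV_chain2[OF flat_has_derivative this]
    show "((\<lambda>x. flat P (a + c * x)) has_real_derivative
        flat ([:0, 0, 1:] * (P - pderiv P)) (a + c * x) * c) (at x)" .
  qed
next
  case (add f g)
  then obtain f' g' where "f' \<in> flat_algebra" "g' \<in> flat_algebra"
    "\<And>x. (f has_real_derivative f' x) (at x)" "\<And>x. (g has_real_derivative g' x) (at x)" by blast
  then show ?case
    by (intro bexI[of _ "\<lambda>x. f' x + g' x"]) (auto intro!: DERIV_add flat_algebra.add)
next
  case (mult f g)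
  then obtain f' g' where "f' \<in> flat_algebra" "g' \<in> flat_algebra"
    "\<And>x. (f has_real_derivative f' x) (at x)" "\<And>x. (g has_real_derivative g' x) (at x)" by blast
  with mult show ?case
    by (intro bexI[of _ "\<lambda>x. f' x * g x + g' x * f x"])
      (auto intro!: DERIV_mult flat_algebra.add flat_algebra.mult)
qed

lemma flat_algebra_deriv: "f \<in> flat_algebra \<Longrightarrow> deriv f \<in> flat_algebra"
proof -
  assume "f \<in> flat_algebra"
  then obtain f' where "f' \<in> flat_algebra" "\<And>x. (f has_real_derivative f' x) (at x)"
    using flat_algebra_has_derivative by blast
  moreover from this have "deriv f = f'" by (auto intro: DERIV_imp_deriv)
  ultimately show ?thesis by simp
qed

lemma flat_algebra_differentiable: "f \<in> flat_algebra \<Longrightarrow> f differentiable (at x)"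
  using flat_algebra_has_derivative real_differentiable_def by blast

lemma flat_algebra_higher_deriv: "f \<in> flat_algebra \<Longrightarrow> (deriv ^^ n) f \<in> flat_algebra"
  by (induction n) (simp_all add: flat_algebra_deriv)

text \<open>For \<open>e > 0\<close> a smooth function that is positive exactly on \<open>(-e, e)\<close>.\<close>
definition bump :: "real \<Rightarrow> real \<Rightarrow> real" where
  "bump e x = flat 1 (e + x) * flat 1 (e - x)"

lemma flat_1_nonneg: "0 \<le> flat 1 x" and flat_1_pos: "0 < flat 1 x \<longleftrightarrow> 0 < x"
  and flat_1_eq_0: "flat 1 x = 0 \<longleftrightarrow> x \<le> 0"
  by (auto simp: flat_def)

lemma bump_nonneg: "0 \<le> bump e x"
  by (simp add: bump_def flat_1_nonneg)

lemma bump_eq_0: "e \<le> \<bar>x\<bar> \<Longrightarrow> bump e x = 0"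
  by (auto simp: bump_def flat_1_eq_0)

lemma bump_pos: "0 < e \<Longrightarrow> 0 < bump e 0"
  by (simp add: bump_def flat_1_pos)

lemma bump_flat_algebra: "(\<lambda>x. bump e (x - s)) \<in> flat_algebra"
proof -
  have "(\<lambda>x. flat 1 ((e - s) + 1 * x) * flat 1 ((e + s) + (-1) * x)) \<in> flat_algebra"
    by (intro flat_algebra.intros)
  then show ?thesis by (simp add: bump_def algebra_simps)
qed

lemma isCont_bump: "isCont (bump e) x"
  using flat_algebra_differentiable[OF bump_flat_algebra[of e 0]]
  by (simp add: differentiable_imp_continuous_within)

text \<open>
  The function is \<open>K (x - s) - K (x - t)\<close> for an antiderivative \<open>K\<close> of the bump: a smooth step.  The
  steps cancel outside a neighbourhood of the segment between \<open>s\<close> and \<open>t\<close>, which gives compact support.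
\<close>
lemma test_function_between:
  assumes e: "0 < e" and s: "e < s" "s < 1 - e" and t: "e < t" "t < 1 - e"
  shows "\<exists>\<phi>\<in>test_functions. \<forall>x. (\<phi> has_real_derivative bump e (x - s) - bump e (x - t)) (at x)"
proof -
  have "\<exists>K. \<forall>x::real. (-\<infinity>) < ereal x \<longrightarrow> ereal x < \<infinity> \<longrightarrow> (K has_vector_derivative bump e x) (at x)"
    by (rule einterval_antiderivative) (auto simp: isCont_bump)
  then obtain K where K: "\<And>x. (K has_real_derivative bump e x) (at x)"
    by (auto simp: has_real_derivative_iff_has_vector_derivative)
  have K_left: "K x = K (-e)" if "x \<le> -e" for x
  proof (cases "x = -e")
    case False
    then have "x < -e" using that by simp
    then obtain z where "x < z" "z < -e" "K (-e) - K x = (-e - x) * bump e z"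
      using MVT2[of x "-e" K "bump e"] K by blast
    then show ?thesis by (simp add: bump_eq_0)
  qed simp
  have K_right: "K x = K e" if "e \<le> x" for x
  proof (cases "x = e")
    case False
    then have "e < x" using that by simp
    then obtain z where "e < z" "z < x" "K x - K e = (x - e) * bump e z"
      using MVT2[of e x K "bump e"] K by blast
    then show ?thesis by (simp add: bump_eq_0)
  qed simp
  define \<phi> where "\<phi> x = K (x - s) - K (x - t)" for x
  have deriv: "(\<phi> has_real_derivative bump e (x - s) - bump e (x - t)) (at x)" for x
    unfolding \<phi>_def by (intro DERIV_diff DERIV_chain2[OF K, where s = UNIV, THEN DERIV_cong])
      (auto intro!: derivative_eq_intros)
  have "deriv \<phi> = (\<lambda>x. bump e (x - s) + (-1) * bump e (x - t))"
    using deriv by (auto intro!: DERIV_imp_deriv)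
  also have "\<dots> \<in> flat_algebra" by (intro flat_algebra.intros bump_flat_algebra)
  finally have alg: "deriv \<phi> \<in> flat_algebra" .
  have "(deriv ^^ n) \<phi> differentiable (at x)" for n x
  proof (cases n)
    case 0
    then show ?thesis using deriv real_differentiable_def by auto
  next
    case (Suc m)
    then show ?thesis
      using flat_algebra_differentiable[OF flat_algebra_higher_deriv[OF alg, of m]]
      by (simp add: funpow_Suc_right del: funpow.simps)
  qed
  moreover have supp: "{x. \<phi> x \<noteq> 0} \<subseteq> {min s t - e..max s t + e}"
  proof (rule subsetI, rule ccontr)
    fix x assume "x \<in> {x. \<phi> x \<noteq> 0}" "x \<notin> {min s t - e..max s t + e}"
    moreover from this have "(x - s \<le> -e \<and> x - t \<le> -e) \<or> (e \<le> x - s \<and> e \<le> x - t)" by auto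
    then have "\<phi> x = 0" unfolding \<phi>_def using K_left[of "x - s"] K_left[of "x - t"] K_right[of "x - s"] K_right[of "x - t"]
      by auto
    ultimately show False by simp
  qed
  then have clos: "closure {x. \<phi> x \<noteq> 0} \<subseteq> {min s t - e..max s t + e}"
    by (rule closure_minimal) simp
  then have "compact (closure {x. \<phi> x \<noteq> 0})"
    by (metis bounded_subset bounded_closed_interval closed_closure compact_eq_bounded_closed)
  moreover have "closure {x. \<phi> x \<noteq> 0} \<subseteq> {0<..<1}"
    by (rule order_trans[OF clos]) (use e s t in auto)
  ultimately have "\<phi> \<in> test_functions" by (simp add: test_functions_def)
  then show ?thesis using deriv by blast
qed

text \<open>
  On continuous functions the Lebesgue integral over the open interval agrees with the gauge
  integral over the closed one, for which the fundamental theorem of calculus is available.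
\<close>
lemma continuous_integral_leb01:
  fixes g :: "real \<Rightarrow> real"
  assumes "continuous_on {0..1} g"
  shows "integrable leb01 g" and "(\<integral>x. g x \<partial>leb01) = integral {0..1} g"
proof -
  have "g absolutely_integrable_on {0..1}"
    using assms by (simp add: absolutely_integrable_continuous_real)
  then have a: "g absolutely_integrable_on {0<..<1}"
    by (rule set_integrable_subset) auto
  then show "integrable leb01 g" 
    by (simp add: set_integrable_def integrable_restrict_space)
  then have "(\<integral>x. g x \<partial>leb01) = integral {0<..<1} g"
    by (intro lebesgue_integral_eq_integral) auto
  also have "\<dots> = integral {0..1} g"
    using integral_open_interval_real[of 0 1 g] by simp
  finally show "(\<integral>x. g x \<partial>leb01) = integral {0..1} g" .
qed

text \<open>
  If \<open>U s > U t\<close>, let \<open>m\<close> be the midpoint of the two values and test with a function whose derivative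
  \<open>w\<close> is a bump around \<open>s\<close> minus a bump around \<open>t\<close>, so narrow that \<open>U > m\<close> on the first and \<open>U < m\<close>
  on the second.  Since \<open>w\<close> has integral zero, \<open>\<integral>(U - m) w = \<integral>U w = 0\<close>; but the integrand is
  continuous, nonnegative and positive at \<open>s\<close>.
\<close>
lemma du_bois_reymond_le:
  assumes U: "continuous_on {0..1} U"
    and zero: "\<And>\<phi>. \<phi> \<in> test_functions \<Longrightarrow> (\<integral>x. U x * deriv \<phi> x \<partial>leb01) = 0"
    and s: "0 < s" "s < 1" and t: "0 < t" "t < 1"
  shows "U s \<le> U t"
proof (rule ccontr)
  assume less: "\<not> U s \<le> U t"
  define m where "m = (U s + U t) / 2"
  have cont: "isCont U s" "isCont U t" using U s t by (auto intro: continuous_on_interior)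
  have "\<forall>\<^sub>F x in nhds s. m < U x" "\<forall>\<^sub>F x in nhds t. U x < m"
    using less order_tendstoD(1)[of U "U s" "nhds s" m] order_tendstoD(2)[of U "U t" "nhds t" m] cont
    unfolding isCont_def tendsto_at_iff_tendsto_nhds by (auto simp: m_def field_simps)
  then obtain d1 d2 where d: "0 < d1" "\<And>x. \<bar>x - s\<bar> < d1 \<Longrightarrow> m < U x"
      "0 < d2" "\<And>x. \<bar>x - t\<bar> < d2 \<Longrightarrow> U x < m"
    unfolding eventually_nhds_metric dist_real_def by blast
  define e where "e = Min {d1, d2, s/2, (1-s)/2, t/2, (1-t)/2}"
  have "0 < e" using d(1,3) s t by (simp add: e_def)
  moreover have "e \<le> y" if "y \<in> {d1, d2, s/2, (1-s)/2, t/2, (1-t)/2}" for y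
    unfolding e_def using that by (intro Min_le) auto
  from this[of d1] this[of d2] this[of "s/2"] this[of "(1-s)/2"] this[of "t/2"] this[of "(1-t)/2"]
  have "e \<le> d1" "e \<le> d2" "e \<le> s/2" "e \<le> (1-s)/2" "e \<le> t/2" "e \<le> (1-t)/2" by auto
  ultimately have e: "0 < e" "e \<le> d1" "e \<le> d2" "e < s" "s < 1 - e" "e < t" "t < 1 - e"
    using s t by (auto simp: field_simps)
  define w where "w x = bump e (x - s) - bump e (x - t)" for x
  obtain \<phi> where \<phi>: "\<phi> \<in> test_functions" "\<And>x. (\<phi> has_real_derivative w x) (at x)"
    using test_function_between[OF e(1) e(4-7)] unfolding w_def by blast
  have d\<phi>: "deriv \<phi> = w" using \<phi>(2) by (auto intro: DERIV_imp_deriv)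
  have wcont: "continuous_on {0..1} w"
    unfolding w_def
    by (intro continuous_intros continuous_at_imp_continuous_on ballI
        differentiable_imp_continuous_within flat_algebra_differentiable bump_flat_algebra)
  have supp: "x \<in> {0<..<1}" if "\<phi> x \<noteq> 0" for x
    using \<phi>(1) that closure_subset[of "{x. \<phi> x \<noteq> 0}"] by (auto simp: test_functions_def)
  have "\<phi> 0 = 0" "\<phi> 1 = 0" using supp[of 0] supp[of 1] by auto
  moreover have "(w has_integral \<phi> 1 - \<phi> 0) {0..1}"
    using \<phi>(2) by (intro fundamental_theorem_of_calculus)
      (auto simp: has_real_derivative_iff_has_vector_derivative[symmetric] intro: has_field_derivative_at_within)
  ultimately have w0: "integral {0..1} w = 0" by (simp add: integral_unique)
  have wU: "integral {0..1} (\<lambda>x. U x * w x) = 0"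
    using zero[OF \<phi>(1)] continuous_integral_leb01(2)[OF continuous_on_mult[OF U wcont]] by (simp add: d\<phi>)
  define g where "g x = (U x - m) * w x" for x
  have gcont: "continuous_on {0..1} g" unfolding g_def by (intro continuous_intros U wcont)
  have "integral {0..1} g = integral {0..1} (\<lambda>x. U x * w x) - m * integral {0..1} w"
    unfolding g_def left_diff_distrib
    by (subst integral_diff)
      (auto intro!: integrable_continuous_real continuous_intros U wcont)
  then have "integral {0..1} g = 0" by (simp add: w0 wU)
  moreover have g_nonneg: "0 \<le> g x" for x
  proof -
    have "0 \<le> (U x - m) * bump e (x - s)"
      using d(2)[of x] bump_eq_0[of e "x - s"] bump_nonneg[of e "x - s"] e(2)
      by (cases "\<bar>x - s\<bar> < e") (auto intro!: mult_nonneg_nonneg)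
    moreover have "0 \<le> (m - U x) * bump e (x - t)"
      using d(4)[of x] bump_eq_0[of e "x - t"] bump_nonneg[of e "x - t"] e(3)
      by (cases "\<bar>x - t\<bar> < e") (auto intro!: mult_nonneg_nonneg)
    ultimately show ?thesis by (simp add: g_def w_def algebra_simps)
  qed
  ultimately have "g s = 0"
    using integral_eq_0_iff[of 0 "1::real" g] gcont s by (auto simp: cbox_interval)
  moreover have "0 < g s"
  proof -
    have "\<not> \<bar>t - s\<bar> < d1" using d(2)[of t] less by (auto simp: m_def)
    then have "e \<le> \<bar>s - t\<bar>" using e(2) by linarith
    then have "w s = bump e 0" by (simp add: w_def bump_eq_0)
    then show ?thesis using bump_pos[OF e(1)] less by (simp add: g_def m_def field_simps)
  qed
  ultimately show False by simp
qed

text \<open>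
  The inequality above is symmetric in its two points, so \<open>U\<close> is constant in the interior and, by
  continuity, up to the boundary.
\<close>
lemma du_bois_reymond:
  assumes U: "continuous_on {0..1} U"
    and zero: "\<And>\<phi>. \<phi> \<in> test_functions \<Longrightarrow> (\<integral>x. U x * deriv \<phi> x \<partial>leb01) = 0"
    and x: "x \<in> {0..1}"
  shows "U x = U 0"
proof -
  have "U y = U (1/2)" if "y \<in> {0<..<1}" for y
  proof (rule antisym)
    show "U y \<le> U (1/2)" by (rule du_bois_reymond_le[OF U zero]) (use that in auto)
    show "U (1/2) \<le> U y" by (rule du_bois_reymond_le[OF U zero]) (use that in auto)
  qed
  then have const: "U y = U (1/2)" if "y \<in> {0..1}" for y
    using continuous_constant_on_closure[of "{0<..<1}" U "U (1/2)" y] U that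
    unfolding closure_greaterThanLessThan[OF zero_less_one] by blast
  show ?thesis unfolding const[OF x] by (rule const[symmetric]) simp
qed

section \<open>Square integrable functions on the unit interval\<close>

lemma L2_01_eq: "L2_01 = square_integrable leb01"
  by (simp add: L2_01_def square_integrable_def)

interpretation L2: semi_inner L2_01 "\<lambda>f g. \<integral>x. f x * g x \<partial>leb01"
  unfolding L2_01_eq by (rule semi_inner_L2)

lemma L2_norm_eq: "L2_norm F = sqrt (\<integral>x. F x * F x \<partial>leb01)"
  by (simp add: L2_norm_def power2_eq_square)

lemma finite_measure_leb01: "finite_measure leb01"
  by (rule finite_measure_lebesgue_on) simp

interpretation leb01: finite_measure leb01 by (rule finite_measure_leb01)

lemma space_leb01: "space leb01 = {0<..<1}"
  by simp

lemma borel_sets_leb01: "A \<in> sets borel \<Longrightarrow> A \<inter> {0<..<1} \<in> sets leb01"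
  by (simp add: sets_restrict_space_iff)

lemma measurable_ident_leb01: "(\<lambda>x. x) \<in> borel_measurable leb01"
proof (rule measurableI)
  fix A :: "real set" assume "A \<in> sets borel"
  moreover have "(\<lambda>x. x) -` A \<inter> space leb01 = A \<inter> {0<..<1}" by (auto simp: space_leb01)
  ultimately show "(\<lambda>x. x) -` A \<inter> space leb01 \<in> sets leb01" using borel_sets_leb01 by simp
qed simp

lemma indicator_L2_01:
  assumes A: "A \<in> sets borel"
  shows "indicator A \<in> L2_01"
proof -
  have m: "indicator A \<in> borel_measurable leb01"
    using measurable_compose[OF measurable_ident_leb01 borel_measurable_indicator[OF A]] by simp
  moreover have "(\<lambda>x. (indicat_real A x)\<^sup>2) = indicator A" by (auto simp: indicator_def)
  moreover have "integrable leb01 (indicat_real A)"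
    by (rule leb01.integrable_const_bound[where B = 1]) (use m in auto)
  ultimately show ?thesis by (simp add: L2_01_def)
qed

lemma continuous_L2_01:
  assumes "continuous_on {0..1} u"
  shows "u \<in> L2_01"
  using continuous_integral_leb01(1)[OF assms]
    continuous_integral_leb01(1)[OF continuous_on_power[OF assms, of 2]]
  by (simp add: L2_01_def)

lemma integrable_L2_01: "v \<in> L2_01 \<Longrightarrow> integrable leb01 v"
  using integrable_mult_square_integrable[of "\<lambda>x. 1" leb01 v] continuous_L2_01[of "\<lambda>x. 1"]
  by (simp add: L2_01_eq)

lemma integrable_mult_L2_01: "u \<in> L2_01 \<Longrightarrow> v \<in> L2_01 \<Longrightarrow> integrable leb01 (\<lambda>x. u x * v x)"
  unfolding L2_01_eq by (rule integrable_mult_square_integrable)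

section \<open>Primitives and weak derivatives\<close>

text \<open>Set to zero off \<open>[0,1]\<close> to agree with the convention for \<open>H1_01\<close>.\<close>
definition primitive :: "(real \<Rightarrow> real) \<Rightarrow> real \<Rightarrow> real" where
  "primitive v x = (if x \<in> {0..1} then \<integral>t. indicator {..x} t * v t \<partial>leb01 else 0)"

lemma primitive_0: "primitive v 0 = 0"
proof -
  have "(\<integral>t. indicator {..0} t * v t \<partial>leb01) = (\<integral>t. 0 \<partial>leb01)"
    by (rule Bochner_Integration.integral_cong) (auto simp: indicator_def)
  then show ?thesis by (simp add: primitive_def)
qed

lemma primitive_outside: "x \<notin> {0..1} \<Longrightarrow> primitive v x = 0"
  by (simp only: primitive_def if_False)

lemma primitive_comb:
  assumes "v \<in> L2_01" "w \<in> L2_01"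
  shows "primitive (\<lambda>x. v x + c * w x) x = primitive v x + c * primitive w x"
proof -
  have i: "indicator {..x} \<in> L2_01" by (rule indicator_L2_01) simp
  show ?thesis
    using L2.lin[OF assms i, of c] by (simp add: primitive_def mult.commute)
qed

lemma primitive_diff:
  assumes "v \<in> L2_01" "w \<in> L2_01"
  shows "primitive (\<lambda>x. v x - w x) x = primitive v x - primitive w x"
  using primitive_comb[OF assms, of "-1" x] by simp

lemma L2_norm_indicator_le:
  assumes "x \<le> y"
  shows "(\<integral>t. indicat_real {x<..y} t * indicat_real {x<..y} t \<partial>leb01) \<le> y - x"
proof -
  have "(\<integral>t. indicat_real {x<..y} t * indicat_real {x<..y} t \<partial>leb01)
      = (\<integral>t. indicat_real ({x<..y} \<inter> {0<..<1}) t \<partial>leb01)"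
    by (rule Bochner_Integration.integral_cong) (auto simp: indicator_def)
  also have "\<dots> = measure lebesgue ({x<..y} \<inter> {0<..<1})"
    by (simp add: borel_sets_leb01 measure_restrict_space)
  also have "\<dots> \<le> measure lebesgue {x<..y}"
    by (intro measure_mono_fmeasurable bounded_set_imp_lmeasurable) auto
  also have "\<dots> = y - x" using assms by simp
  finally show ?thesis .
qed

text \<open>Cauchy--Schwarz against the indicator of the interval between the two points.\<close>
lemma primitive_holder:
  assumes v: "v \<in> L2_01" and x: "x \<in> {0..1}" and y: "y \<in> {0..1}"
  shows "\<bar>primitive v y - primitive v x\<bar> \<le> sqrt \<bar>y - x\<bar> * L2_norm v"
  using x y
proof (induction x y rule: linorder_wlog)
  case (le x y)
  have i: "indicat_real A \<in> L2_01" if "A \<in> sets borel" for A by (rule indicator_L2_01) (rule that)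
  have "primitive v y - primitive v x = (\<integral>t. indicator {..y} t * v t - indicator {..x} t * v t \<partial>leb01)"
    using le integrable_mult_L2_01[OF i v] by (simp add: primitive_def)
  also have "\<dots> = (\<integral>t. indicator {x<..y} t * v t \<partial>leb01)"
    by (rule Bochner_Integration.integral_cong) (use le in \<open>auto simp: indicator_def\<close>)
  finally have "\<bar>primitive v y - primitive v x\<bar>
      \<le> sqrt (\<integral>t. indicator {x<..y} t * indicator {x<..y} t \<partial>leb01) * L2_norm v"
    using L2.cauchy_schwarz_sqrt[OF i v, of "{x<..y}"] by (simp add: L2_norm_eq)
  also have "\<dots> \<le> sqrt \<bar>y - x\<bar> * L2_norm v"
    using L2_norm_indicator_le[OF le(1)] le(1)
    by (intro mult_right_mono real_sqrt_le_mono) (auto simp: L2_norm_def)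
  finally show ?case .
qed (simp add: abs_minus_commute)

lemma primitive_bound:
  assumes v: "v \<in> L2_01"
  shows "\<bar>primitive v x\<bar> \<le> L2_norm v"
proof (cases "x \<in> {0..1}")
  case True
  have "\<bar>primitive v x\<bar> \<le> sqrt \<bar>x\<bar> * L2_norm v"
    using primitive_holder[OF v _ True, of 0] by (simp add: primitive_0)
  also have "\<dots> \<le> 1 * L2_norm v"
    using True by (intro mult_right_mono) (auto simp: L2_norm_def)
  finally show ?thesis by simp
qed (simp add: primitive_outside L2_norm_def)

lemma primitive_continuous:
  assumes v: "v \<in> L2_01"
  shows "continuous_on {0..1} (primitive v)"
  unfolding continuous_on_def
proof
  fix x :: real assume x: "x \<in> {0..1}"
  have "((\<lambda>y. primitive v y - primitive v x) \<longlongrightarrow> 0) (at x within {0..1})"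
  proof (rule Lim_null_comparison)
    show "\<forall>\<^sub>F y in at x within {0..1}. norm (primitive v y - primitive v x) \<le> sqrt \<bar>y - x\<bar> * L2_norm v"
      using primitive_holder[OF v x] by (auto simp: eventually_at_filter)
    have "((\<lambda>y. sqrt \<bar>y - x\<bar> * L2_norm v) \<longlongrightarrow> sqrt \<bar>x - x\<bar> * L2_norm v) (at x within {0..1})"
      by (intro tendsto_intros)
    then show "((\<lambda>y. sqrt \<bar>y - x\<bar> * L2_norm v) \<longlongrightarrow> 0) (at x within {0..1})" by simp
  qed
  then show "(primitive v \<longlongrightarrow> primitive v x) (at x within {0..1})" by (simp add: LIM_zero_iff)
qed

lemma test_function_facts:
  assumes \<phi>: "\<phi> \<in> test_functions"
  shows test_function_deriv: "(\<phi> has_real_derivative deriv \<phi> x) (at x)"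
    and test_function_deriv_cont: "continuous_on S (deriv \<phi>)"
    and test_function_1: "\<phi> 1 = 0"
proof -
  have diff: "(deriv ^^ n) \<phi> differentiable (at x)" for n x
    using \<phi> by (simp add: test_functions_def)
  have "\<phi> differentiable (at x)" for x using diff[of 0] by simp
  then show d: "(\<phi> has_real_derivative deriv \<phi> x) (at x)" for x
    using DERIV_deriv_iff_real_differentiable by blast
  have "isCont (deriv \<phi>) x" for x
    using diff[of 1 x] by (simp add: differentiable_imp_continuous_within)
  then show "continuous_on S (deriv \<phi>)" by (simp add: continuous_at_imp_continuous_on)
  have "1 \<notin> {x. \<phi> x \<noteq> 0}"
    using \<phi> closure_subset[of "{x. \<phi> x \<noteq> 0}"] by (auto simp: test_functions_def)
  then show "\<phi> 1 = 0" by simp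
qed

text \<open>
  The fundamental theorem of calculus on \<open>[t,1]\<close>, written with the kernel that also occurs in
  \<open>primitive\<close>, so that the two can be combined by Fubini's theorem.
\<close>
lemma test_function_from_deriv:
  assumes \<phi>: "\<phi> \<in> test_functions" and t: "t \<in> {0<..<1}"
  shows "(\<integral>x. indicator {..x} t * deriv \<phi> x \<partial>leb01) = - \<phi> t"
proof -
  note d = test_function_deriv_cont[OF \<phi>]
  have "(deriv \<phi> has_integral \<phi> 1 - \<phi> t) {t..1}"
    using t test_function_deriv[OF \<phi>]
    by (intro fundamental_theorem_of_calculus)
      (auto simp: has_real_derivative_iff_has_vector_derivative[symmetric] intro: has_field_derivative_at_within)
  then have I: "integral {t..1} (deriv \<phi>) = - \<phi> t"
    using test_function_1[OF \<phi>] by (simp add: integral_unique)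
  have "deriv \<phi> absolutely_integrable_on {t..1}"
    by (rule absolutely_integrable_continuous_real) (rule d)
  then have a: "set_integrable lebesgue ({t..<1}) (deriv \<phi>)"
    by (rule set_integrable_subset) auto
  have "(\<integral>x. indicator {..x} t * deriv \<phi> x \<partial>leb01) = (LINT x:{0<..<1}|lebesgue. indicator {..x} t * deriv \<phi> x)"
    by (subst integral_restrict_space) (auto simp: set_lebesgue_integral_def)
  also have "\<dots> = (LINT x:{t..<1}|lebesgue. deriv \<phi> x)"
    unfolding set_lebesgue_integral_def
    by (rule Bochner_Integration.integral_cong) (use t in \<open>auto simp: indicator_def\<close>)
  also have "\<dots> = integral {t..<1} (deriv \<phi>)"
    by (rule set_lebesgue_integral_eq_integral(2)[OF a])
  also have "\<dots> = integral {t..1} (deriv \<phi>)"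
    by (rule integral_subset_negligible) (auto intro: negligible_subset[of "{1}"])
  finally show ?thesis using I by simp
qed

text \<open>
  Integration by parts as an exchange of integrals: both sides are the double integral of
  \<open>v t * deriv \<phi> x\<close> over the triangle \<open>t \<le> x\<close>.
\<close>
lemma primitive_has_weak_deriv:
  assumes v: "v \<in> L2_01"
  shows "has_weak_deriv (primitive v) v"
  unfolding has_weak_deriv_def
proof
  fix \<phi> assume \<phi>: "\<phi> \<in> test_functions"
  interpret P: pair_sigma_finite leb01 leb01
    by unfold_locales
  note [measurable] = measurable_ident_leb01
  have [measurable]: "v \<in> borel_measurable leb01" using v by (simp add: L2_01_def)
  have [measurable]: "deriv \<phi> \<in> borel_measurable leb01"
    using continuous_L2_01[OF test_function_deriv_cont[OF \<phi>]] by (simp add: L2_01_def)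
  have "bounded (deriv \<phi> ` {0..1})"
    by (intro compact_imp_bounded compact_continuous_image test_function_deriv_cont[OF \<phi>]) simp
  then obtain C where C: "\<forall>x\<in>{0..1}. \<bar>deriv \<phi> x\<bar> \<le> C"
    unfolding bounded_iff by auto
  define h where "h t x = indicator {..x} t * v t * deriv \<phi> x" for t x
  have h_meas: "case_prod h \<in> borel_measurable (leb01 \<Otimes>\<^sub>M leb01)"
  proof -
    have "(\<lambda>(t, x). (if t \<le> x then 1 else 0) * v t * deriv \<phi> x) \<in> borel_measurable (leb01 \<Otimes>\<^sub>M leb01)"
      by measurable
    then show ?thesis by (simp add: h_def indicator_def case_prod_unfold)
  qed
  have "integrable (leb01 \<Otimes>\<^sub>M leb01) (\<lambda>(t, x). C * v t)"
  proof (rule P.Fubini_integrable)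
    show "integrable leb01 (\<lambda>x. \<integral>y. norm (case (x, y) of (t, x) \<Rightarrow> C * v t) \<partial>leb01)"
      using integrable_L2_01[OF v] by (simp add: abs_mult)
  qed auto
  then have "integrable (leb01 \<Otimes>\<^sub>M leb01) (case_prod h)"
  proof (rule Bochner_Integration.integrable_bound[OF _ h_meas])
    show "AE p in leb01 \<Otimes>\<^sub>M leb01. norm (case_prod h p) \<le> norm (case p of (t, x) \<Rightarrow> C * v t)"
    proof (rule AE_I2)
      fix p assume "p \<in> space (leb01 \<Otimes>\<^sub>M leb01)"
      then obtain t x where p: "p = (t, x)" and x: "x \<in> {0..1}"
        by (auto simp: space_pair_measure)
      have "\<bar>h t x\<bar> \<le> \<bar>deriv \<phi> x\<bar> * \<bar>v t\<bar>" by (simp add: h_def indicator_def abs_mult)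
      also have "\<dots> \<le> \<bar>C\<bar> * \<bar>v t\<bar>" using bspec[OF C x] by (intro mult_right_mono) auto
      finally show "norm (case_prod h p) \<le> norm (case p of (t, x) \<Rightarrow> C * v t)"
        by (simp add: p abs_mult)
    qed
  qed
  then have fubini: "(\<integral>x. (\<integral>t. h t x \<partial>leb01) \<partial>leb01) = (\<integral>t. (\<integral>x. h t x \<partial>leb01) \<partial>leb01)"
    by (rule P.Fubini_integral)
  have "(\<integral>x. primitive v x * deriv \<phi> x \<partial>leb01) = (\<integral>x. (\<integral>t. h t x \<partial>leb01) \<partial>leb01)"
    by (rule Bochner_Integration.integral_cong) (auto simp: primitive_def h_def)
  also have "\<dots> = (\<integral>t. v t * (\<integral>x. indicator {..x} t * deriv \<phi> x \<partial>leb01) \<partial>leb01)"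
    unfolding fubini unfolding h_def integral_mult_right_zero[symmetric] by (simp add: mult_ac)
  also have "\<dots> = (\<integral>t. - (v t * \<phi> t) \<partial>leb01)"
    by (rule Bochner_Integration.integral_cong) (auto simp: test_function_from_deriv[OF \<phi>])
  finally show "(\<integral>x. primitive v x * deriv \<phi> x \<partial>leb01) = - (\<integral>x. v x * \<phi> x \<partial>leb01)" by simp
qed

text \<open>
  The difference of \<open>u\<close> and the primitive of \<open>v\<close> is continuous and has weak derivative zero, hence is
  constant; at \<open>0\<close> it vanishes.
\<close>
lemma weak_deriv_imp_primitive:
  assumes u: "u \<in> H1_01" "u 0 = 0" and v: "v \<in> L2_01" "has_weak_deriv u v"
  shows "u = primitive v"
proof
  fix x
  have cu: "continuous_on {0..1} u" using u by (simp add: H1_01_def)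
  show "u x = primitive v x"
  proof (cases "x \<in> {0..1}")
    case True
    have "u x - primitive v x = u 0 - primitive v 0"
    proof (rule du_bois_reymond[OF _ _ True])
      show "continuous_on {0..1} (\<lambda>x. u x - primitive v x)"
        by (intro continuous_intros cu primitive_continuous v)
      fix \<phi> assume \<phi>: "\<phi> \<in> test_functions"
      have "(\<integral>x. (u x - primitive v x) * deriv \<phi> x \<partial>leb01)
          = (\<integral>x. u x * deriv \<phi> x \<partial>leb01) - (\<integral>x. primitive v x * deriv \<phi> x \<partial>leb01)"
        by (rule L2.diff_left)
          (intro continuous_L2_01 cu primitive_continuous v test_function_deriv_cont[OF \<phi>])+
      also have "\<dots> = 0"
        using v(2) primitive_has_weak_deriv[OF v(1)] \<phi> by (simp add: has_weak_deriv_def)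
      finally show "(\<integral>x. (u x - primitive v x) * deriv \<phi> x \<partial>leb01) = 0" .
    qed
    then show ?thesis using u by (simp add: primitive_0)
  next
    case False
    then show ?thesis using u(1) primitive_outside[OF False] by (auto simp: H1_01_def)
  qed
qed

lemma primitive_H1_01: "v \<in> L2_01 \<Longrightarrow> primitive v \<in> H1_01"
  using primitive_continuous[of v] continuous_L2_01 primitive_outside[of _ v] primitive_has_weak_deriv[of v]
  unfolding H1_01_def by blast

text \<open>
  The integral of \<open>w\<close> vanishes over all half-lines \<open>{..a}\<close>, which form an intersection-stable
  generator of the Borel sets, hence over all Borel sets; null sets do not matter, so it vanishes
  over all Lebesgue sets.
\<close>
lemma primitive_eq_0_imp_AE:
  assumes w: "w \<in> L2_01" and zero: "\<And>x. primitive w x = 0"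
  shows "AE x in leb01. w x = 0"
proof (rule leb01.density_zero)
  show int: "integrable leb01 w" by (rule integrable_L2_01[OF w])
  have set_int: "set_integrable leb01 S w" if "S \<in> sets leb01" for S
    using integrable_mult_indicator[OF that int] by (simp add: set_integrable_def)
  let ?I = "\<lambda>A. LINT x:(A \<inter> {0<..<1})|leb01. w x"
  have atMost: "?I {..a} = 0" for a
  proof -
    have "?I {..a} = primitive w (max 0 (min 1 a))"
      unfolding set_lebesgue_integral_def primitive_def
      by (auto intro!: Bochner_Integration.integral_cong simp: indicator_def)
    then show ?thesis by (simp add: zero)
  qed
  have borel: "?I A = 0" if "A \<in> sets borel" for A
  proof -
    let ?G = "range (\<lambda>a::real. {..a})"
    have sig: "sigma_sets UNIV ?G = sets borel" by (subst borel_eq_atMost) simp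
    have "Int_stable ?G" by (auto simp: Int_stable_def)
    moreover have "?G \<subseteq> Pow UNIV" by simp
    moreover have "A \<in> sigma_sets UNIV ?G" using that by (simp only: sig)
    ultimately show ?thesis
    proof (induction rule: sigma_sets_induct_disjoint)
      case (basic A)
      then show ?case using atMost by auto
    next
      case empty
      show ?case by (simp add: set_lebesgue_integral_def)
    next
      case (compl A)
      have A: "A \<in> sets borel" using compl(1) by (simp only: sig)
      have "?I UNIV = ?I A + ?I (UNIV - A)"
        by (subst set_integral_Un[symmetric])
          (use A in \<open>auto intro!: set_int borel_sets_leb01 arg_cong[where f = "\<lambda>S. LINT x:S|leb01. w x"]\<close>)
      moreover have "?I UNIV = ?I {..1}"
        by (auto intro!: arg_cong[where f = "\<lambda>S. LINT x:S|leb01. w x"])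
      ultimately show ?case using compl atMost by simp
    next
      case (union A)
      have A: "A i \<in> sets borel" for i using union(2) unfolding sig by auto
      have U: "(\<Union>i. A i) \<inter> {0<..<1} = (\<Union>i. A i \<inter> {0<..<1})" by auto
      have "?I (\<Union>i. A i) = (\<Sum>i. ?I (A i))"
        unfolding U
        by (rule lebesgue_integral_countable_add)
          (use union(1) A in \<open>auto simp: disjoint_family_on_def intro!: set_int borel_sets_leb01 sets.countable_UN\<close>)
      then show ?case using union(3) by simp
    qed
  qed
  fix S assume S: "S \<in> sets leb01"
  then have "S \<in> sets lebesgue" "S \<subseteq> {0<..<1}" by (auto simp: sets_restrict_space_iff)
  \<comment> \<open>A Lebesgue set is a Borel set up to a null set.\<close>
  then obtain A N N' where A: "S = A \<union> N" "N \<subseteq> N'" "N' \<in> null_sets lborel" "A \<in> sets lborel"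
    by (auto elim: sets_completionE)
  have "AE x in lebesgue. x \<notin> N'"
    using A(3) by (intro AE_not_in null_sets_completionI)
  then have "AE x in leb01. x \<notin> N'" by (auto simp: AE_restrict_space_iff elim: eventually_mono)
  moreover have "(x \<in> S) = (x \<in> A \<inter> {0<..<1})" if "x \<notin> N'" for x
    using that A \<open>S \<subseteq> {0<..<1}\<close> by auto
  ultimately have "AE x in leb01. (x \<in> S) = (x \<in> A \<inter> {0<..<1})"
    by (rule eventually_mono)
  moreover have "A \<inter> {0<..<1} \<in> sets leb01" using A(4) by (intro borel_sets_leb01) simp
  ultimately have "(LINT x:S|leb01. w x) = ?I A"
    using set_int S unfolding set_integrable_def
    by (intro set_integral_cong_set) (auto simp: set_borel_measurable_def)
  then show "(LINT x:S|leb01. w x) = 0" using borel A(4) by simp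
qed

lemma primitive_inj_AE:
  assumes "v \<in> L2_01" "w \<in> L2_01" "primitive v = primitive w"
  shows "AE x in leb01. v x = w x"
  using primitive_eq_0_imp_AE[OF L2.diff[OF assms(1,2)]] primitive_diff[OF assms(1,2)] assms(3)
  by simp

lemma weak_deriv_spec:
  assumes "u \<in> H1_01"
  shows "weak_deriv u \<in> L2_01" and "has_weak_deriv u (weak_deriv u)"
proof -
  have "\<exists>v. v \<in> L2_01 \<and> has_weak_deriv u v" using assms by (auto simp: H1_01_def)
  from someI_ex[OF this] show "weak_deriv u \<in> L2_01" "has_weak_deriv u (weak_deriv u)"
    by (simp_all add: weak_deriv_def)
qed

lemma primitive_weak_deriv: "u \<in> H1_01 \<Longrightarrow> u 0 = 0 \<Longrightarrow> primitive (weak_deriv u) = u"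
  using weak_deriv_imp_primitive[of u "weak_deriv u"] weak_deriv_spec by simp

lemma weak_deriv_primitive:
  assumes "v \<in> L2_01"
  shows "AE x in leb01. weak_deriv (primitive v) x = v x"
  using assms primitive_H1_01[OF assms] weak_deriv_spec(1) primitive_weak_deriv[of "primitive v"] primitive_0[of v]
  by (intro primitive_inj_AE) auto

section \<open>The Hilbert space of the problem\<close>

lemma ell2_iff: "f \<in> ell2 B \<longleftrightarrow> (\<lambda>b. (f b)\<^sup>2) summable_on B"
  by (simp add: ell2_def)

lemma ell2_norm_eq: "ell2_norm B f = sqrt (\<Sum>\<^sub>\<infinity>b\<in>B. f b * f b)"
  by (simp add: ell2_norm_def power2_eq_square)

lemma summable_mult_ell2:
  assumes f: "f \<in> ell2 B" and g: "g \<in> ell2 B"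
  shows "(\<lambda>b. f b * g b) summable_on B"
proof -
  have "(\<lambda>b. (f b)\<^sup>2 + (g b)\<^sup>2) summable_on B"
    using f g by (intro summable_on_add) (simp_all add: ell2_iff)
  then have "(\<lambda>b. norm ((f b)\<^sup>2 + (g b)\<^sup>2)) summable_on B" by simp
  then have "(\<lambda>b. norm (f b * g b)) summable_on B"
  proof (rule Infinite_Sum.abs_summable_on_comparison_test)
    fix b
    show "norm (f b * g b) \<le> norm ((f b)\<^sup>2 + (g b)\<^sup>2)"
      using abs_mult_le_squares[of "f b" "g b"] by simp
  qed
  then show ?thesis by (rule Infinite_Sum.abs_summable_summable)
qed

interpretation ell2: semi_inner "ell2 B" "\<lambda>f g. \<Sum>\<^sub>\<infinity>b\<in>B. f b * g b" for B
proof
  show "(\<lambda>x. 0) \<in> ell2 B" by (simp add: ell2_iff)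
  fix u v w :: "real \<Rightarrow> real" and c
  assume u: "u \<in> ell2 B"
  show "0 \<le> (\<Sum>\<^sub>\<infinity>b\<in>B. u b * u b)" by (rule infsum_nonneg) simp
  assume v: "v \<in> ell2 B"
  have "(\<lambda>b. (u b)\<^sup>2 + ((2 * c) * (u b * v b) + c\<^sup>2 * (v b)\<^sup>2)) summable_on B"
    using u v summable_mult_ell2[OF u v]
    by (intro summable_on_add summable_on_cmult_right) (simp_all add: ell2_iff)
  also have "(\<lambda>b. (u b)\<^sup>2 + ((2 * c) * (u b * v b) + c\<^sup>2 * (v b)\<^sup>2)) = (\<lambda>b. (u b + c * v b)\<^sup>2)"
    by (auto simp: power2_eq_square algebra_simps)
  finally show "(\<lambda>x. u x + c * v x) \<in> ell2 B" by (simp add: ell2_iff)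
  show "(\<Sum>\<^sub>\<infinity>b\<in>B. u b * v b) = (\<Sum>\<^sub>\<infinity>b\<in>B. v b * u b)" by (simp add: mult.commute)
  assume w: "w \<in> ell2 B"
  show "(\<Sum>\<^sub>\<infinity>b\<in>B. (u b + c * v b) * w b) = (\<Sum>\<^sub>\<infinity>b\<in>B. u b * w b) + c * (\<Sum>\<^sub>\<infinity>b\<in>B. v b * w b)"
    using summable_mult_ell2[OF u w] summable_mult_ell2[OF v w]
    by (simp add: distrib_right mult.assoc infsum_add summable_on_cmult_right infsum_cmult_right)
qed

lemma V_space_iff: "u \<in> V_space B \<longleftrightarrow> u \<in> H1_01 \<and> u 0 = 0 \<and> u \<in> ell2 B"
  by (simp add: V_space_def ell2_def)

lemma V_spaceD:
  assumes "u \<in> V_space B"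
  shows "weak_deriv u \<in> L2_01" "primitive (weak_deriv u) = u" "u \<in> ell2 B" "u \<in> L2_01"
  using assms weak_deriv_spec(1) primitive_weak_deriv by (auto simp: V_space_iff H1_01_def)

lemma primitive_V_space: "v \<in> L2_01 \<Longrightarrow> primitive v \<in> ell2 B \<Longrightarrow> primitive v \<in> V_space B"
  by (simp add: V_space_iff primitive_H1_01 primitive_0)

definition energy :: "real set \<Rightarrow> real \<Rightarrow> (real \<Rightarrow> real) \<Rightarrow> (real \<Rightarrow> real) \<Rightarrow> real" where
  "energy B \<beta> u v = (\<integral>x. weak_deriv u x * weak_deriv v x \<partial>leb01) + \<beta> * (\<Sum>\<^sub>\<infinity>b\<in>B. u b * v b)"

text \<open>
  Writing combinations as primitives reduces the linearity of the weak derivative, which \<open>weak_deriv\<close>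
  as an arbitrary choice does not have on the nose, to its uniqueness almost everywhere.
\<close>
lemma comb_eq_primitive:
  assumes "u \<in> V_space B" "v \<in> V_space B"
  shows "(\<lambda>x. u x + c * v x) = primitive (\<lambda>x. weak_deriv u x + c * weak_deriv v x)"
  using primitive_comb[OF V_spaceD(1)[OF assms(1)] V_spaceD(1)[OF assms(2)]]
  by (auto simp: V_spaceD(2)[OF assms(1)] V_spaceD(2)[OF assms(2)])

lemma V_space_comb:
  assumes "u \<in> V_space B" "v \<in> V_space B"
  shows "(\<lambda>x. u x + c * v x) \<in> V_space B"
  using ell2.comb[OF V_spaceD(3)[OF assms(1)] V_spaceD(3)[OF assms(2)], of c]
  unfolding comb_eq_primitive[OF assms]
  by (intro primitive_V_space L2.comb V_spaceD(1)[OF assms(1)] V_spaceD(1)[OF assms(2)])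

lemma weak_deriv_comb:
  assumes "u \<in> V_space B" "v \<in> V_space B"
  shows "AE x in leb01. weak_deriv (\<lambda>x. u x + c * v x) x = weak_deriv u x + c * weak_deriv v x"
  unfolding comb_eq_primitive[OF assms]
  by (intro weak_deriv_primitive L2.comb V_spaceD(1)[OF assms(1)] V_spaceD(1)[OF assms(2)])

lemma L2_inner_cong_AE:
  assumes "u \<in> L2_01" "u' \<in> L2_01" "v \<in> L2_01" "v' \<in> L2_01"
    and "AE x in leb01. u x = u' x" "AE x in leb01. v x = v' x"
  shows "(\<integral>x. u x * v x \<partial>leb01) = (\<integral>x. u' x * v' x \<partial>leb01)"
proof (rule integral_cong_AE)
  show "AE x in leb01. u x * v x = u' x * v' x"
    using assms(5,6) by eventually_elim simp
qed (use assms in \<open>auto simp: L2_01_def\<close>)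

lemma semi_inner_energy:
  assumes "0 \<le> \<beta>"
  shows "semi_inner (V_space B) (energy B \<beta>)"
proof
  show "(\<lambda>x. 0) \<in> V_space B"
  proof -
    have "primitive (\<lambda>x. 0) = (\<lambda>x. 0)" by (simp add: primitive_def fun_eq_iff)
    then show ?thesis using primitive_V_space[OF L2.zero, of B] ell2.zero[of B] by simp
  qed
  fix u v w :: "real \<Rightarrow> real" and c
  assume u: "u \<in> V_space B"
  show "0 \<le> energy B \<beta> u u"
    using assms L2.nonneg[OF V_spaceD(1)[OF u]] ell2.nonneg[OF V_spaceD(3)[OF u]] by (simp add: energy_def)
  assume v: "v \<in> V_space B"
  show "(\<lambda>x. u x + c * v x) \<in> V_space B" using u v by (rule V_space_comb)
  show "energy B \<beta> u v = energy B \<beta> v u" by (simp add: energy_def mult.commute)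
  assume w: "w \<in> V_space B"
  have "(\<integral>x. weak_deriv (\<lambda>x. u x + c * v x) x * weak_deriv w x \<partial>leb01)
      = (\<integral>x. (weak_deriv u x + c * weak_deriv v x) * weak_deriv w x \<partial>leb01)"
    using V_spaceD(1)[OF V_space_comb[OF u v]] V_spaceD(1)[OF w] V_spaceD(1)[OF u] V_spaceD(1)[OF v]
      weak_deriv_comb[OF u v]
    by (intro L2_inner_cong_AE L2.comb) auto
  then show "energy B \<beta> (\<lambda>x. u x + c * v x) w = energy B \<beta> u w + c * energy B \<beta> v w"
    using L2.lin[OF V_spaceD(1)[OF u] V_spaceD(1)[OF v] V_spaceD(1)[OF w], of c]
      ell2.lin[OF V_spaceD(3)[OF u] V_spaceD(3)[OF v] V_spaceD(3)[OF w], of c]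
    by (simp add: energy_def distrib_left algebra_simps)
qed

lemma energy_diff:
  assumes u: "u \<in> V_space B" and v: "v \<in> V_space B"
  shows "energy B \<beta> (\<lambda>x. u x - v x) (\<lambda>x. u x - v x)
    = (\<integral>x. (weak_deriv u x - weak_deriv v x)\<^sup>2 \<partial>leb01) + \<beta> * (\<Sum>\<^sub>\<infinity>b\<in>B. (u b - v b)\<^sup>2)"
proof -
  have d: "(\<lambda>x. u x - v x) \<in> V_space B" "(\<lambda>x. weak_deriv u x - weak_deriv v x) \<in> L2_01"
    using V_space_comb[OF u v, of "-1"] L2.diff[OF V_spaceD(1)[OF u] V_spaceD(1)[OF v]] by auto
  have "(\<integral>x. weak_deriv (\<lambda>x. u x - v x) x * weak_deriv (\<lambda>x. u x - v x) x \<partial>leb01)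
      = (\<integral>x. (weak_deriv u x - weak_deriv v x) * (weak_deriv u x - weak_deriv v x) \<partial>leb01)"
    using weak_deriv_comb[OF u v, of "-1"] V_spaceD(1)[OF d(1)] d(2)
    by (intro L2_inner_cong_AE) auto
  then show ?thesis by (simp add: energy_def power2_eq_square)
qed

text \<open>
  The derivatives converge in \<open>L\<^sup>2\<close> to some \<open>w\<close>, and the functions converge pointwise to its primitive
  \<open>u\<close>.  The sums over \<open>B\<close> are controlled on each finite subset by letting \<open>m\<close> tend to infinity in the
  Cauchy condition for \<open>s n - s m\<close>; the bound does not depend on the subset and so passes to \<open>B\<close>.
\<close>
lemma energy_complete:
  fixes s :: "nat \<Rightarrow> real \<Rightarrow> real"
  assumes \<beta>: "0 < \<beta>" and s: "\<And>n. s n \<in> V_space B"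
    and Cauchy: "\<And>e. 0 < e \<Longrightarrow>
      \<exists>N. \<forall>m\<ge>N. \<forall>n\<ge>N. energy B \<beta> (\<lambda>x. s m x - s n x) (\<lambda>x. s m x - s n x) < e"
  shows "\<exists>u\<in>V_space B. (\<lambda>n. energy B \<beta> (\<lambda>x. s n x - u x) (\<lambda>x. s n x - u x)) \<longlonglongrightarrow> 0"
proof -
  define v where "v n = weak_deriv (s n)" for n
  have v: "v n \<in> L2_01" for n unfolding v_def by (rule V_spaceD(1)[OF s])
  have prim: "primitive (v n) = s n" for n unfolding v_def by (rule V_spaceD(2)[OF s])
  note split = energy_diff[OF s s, of \<beta>, folded v_def]
  have pos: "0 \<le> (\<integral>x. (v m x - v n x)\<^sup>2 \<partial>leb01)" "0 \<le> \<beta> * (\<Sum>\<^sub>\<infinity>b\<in>B. (s m b - s n b)\<^sup>2)" for m n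
    using \<beta> by (auto intro!: infsum_nonneg mult_nonneg_nonneg)
  have "\<exists>N. \<forall>m\<ge>N. \<forall>n\<ge>N. (\<integral>x. (v m x - v n x)\<^sup>2 \<partial>leb01) < e" if "0 < e" for e
    using Cauchy[OF that] pos(2) unfolding split by (meson add_increasing2 order_refl le_less_trans)
  then obtain w where w: "w \<in> L2_01" and lim_w: "(\<lambda>n. \<integral>x. (v n x - w x)\<^sup>2 \<partial>leb01) \<longlonglongrightarrow> 0"
    using L2_complete[of v leb01] v unfolding L2_01_eq by blast
  define u where "u = primitive w"
  have lim_u: "(\<lambda>n. s n x) \<longlonglongrightarrow> u x" for x
  proof -
    have "(\<lambda>n. s n x - u x) \<longlonglongrightarrow> 0"
    proof (rule Lim_null_comparison)
      show "\<forall>\<^sub>F n in sequentially. norm (s n x - u x) \<le> sqrt (\<integral>x. (v n x - w x)\<^sup>2 \<partial>leb01)"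
        using primitive_bound[OF L2.diff[OF v w], of _ x] primitive_diff[OF v w, of _ x]
        by (simp add: prim u_def L2_norm_def)
      show "(\<lambda>n. sqrt (\<integral>x. (v n x - w x)\<^sup>2 \<partial>leb01)) \<longlonglongrightarrow> 0"
        using tendsto_real_sqrt[OF lim_w] by simp
    qed
    then show ?thesis by (rule LIM_zero_cancel)
  qed
  have finite_bound: "(\<Sum>b\<in>F. (s n b - u b)\<^sup>2) \<le> e"
    if "finite F" "F \<subseteq> B" and n: "\<And>m. m \<ge> n \<Longrightarrow> (\<Sum>\<^sub>\<infinity>b\<in>B. (s n b - s m b)\<^sup>2) \<le> e" for F n e
  proof (rule LIMSEQ_le_const2)
    show "(\<lambda>m. \<Sum>b\<in>F. (s n b - s m b)\<^sup>2) \<longlonglongrightarrow> (\<Sum>b\<in>F. (s n b - u b)\<^sup>2)"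
      by (intro tendsto_intros lim_u)
    have "(\<Sum>b\<in>F. (s n b - s m b)\<^sup>2) \<le> (\<Sum>\<^sub>\<infinity>b\<in>B. (s n b - s m b)\<^sup>2)" for m
      using ell2.diff[OF V_spaceD(3)[OF s[of n]] V_spaceD(3)[OF s[of m]]] that(1,2)
      by (intro finite_sum_le_infsum) (auto simp: ell2_iff)
    then show "\<exists>N. \<forall>m\<ge>N. (\<Sum>b\<in>F. (s n b - s m b)\<^sup>2) \<le> e"
      using n order_trans by blast
  qed
  have tail: "(\<lambda>b. s n b - u b) \<in> ell2 B" "(\<Sum>\<^sub>\<infinity>b\<in>B. (s n b - u b)\<^sup>2) \<le> e"
    if n: "\<And>m. m \<ge> n \<Longrightarrow> (\<Sum>\<^sub>\<infinity>b\<in>B. (s n b - s m b)\<^sup>2) \<le> e" for n e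
  proof -
    have "(\<lambda>b. (s n b - u b)\<^sup>2) summable_on B"
      by (rule nonneg_bounded_partial_sums_imp_summable_on[where C = e])
        (auto intro!: eventually_finite_subsets_at_top_weakI finite_bound[OF _ _ n])
    then show "(\<lambda>b. s n b - u b) \<in> ell2 B" "(\<Sum>\<^sub>\<infinity>b\<in>B. (s n b - u b)\<^sup>2) \<le> e"
      by (auto simp: ell2_iff intro!: infsum_le_finite_sums finite_bound[OF _ _ n])
  qed
  have Cauchy_ell2: "\<exists>N. \<forall>m\<ge>N. \<forall>n\<ge>N. \<beta> * (\<Sum>\<^sub>\<infinity>b\<in>B. (s m b - s n b)\<^sup>2) < e" if "0 < e" for e
    using Cauchy[OF that] pos(1) unfolding split by (meson add_increasing order_refl le_less_trans)
  obtain K where "\<And>m. m \<ge> K \<Longrightarrow> \<beta> * (\<Sum>\<^sub>\<infinity>b\<in>B. (s K b - s m b)\<^sup>2) < 1"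
    using Cauchy_ell2[of 1] by auto
  then have K: "(\<Sum>\<^sub>\<infinity>b\<in>B. (s K b - s m b)\<^sup>2) \<le> 1 / \<beta>" if "m \<ge> K" for m
    using \<beta> that by (simp add: field_simps less_imp_le)
  have "u \<in> ell2 B" using ell2.diff[OF V_spaceD(3)[OF s[of K]] tail(1)[OF K]] by simp
  then have u: "u \<in> V_space B" unfolding u_def by (intro primitive_V_space w)
  have "(\<lambda>n. \<beta> * (\<Sum>\<^sub>\<infinity>b\<in>B. (s n b - u b)\<^sup>2)) \<longlonglongrightarrow> 0"
  proof (rule LIMSEQ_I)
    fix e :: real assume e: "0 < e"
    then obtain N where N: "\<And>m n. m \<ge> N \<Longrightarrow> n \<ge> N \<Longrightarrow> \<beta> * (\<Sum>\<^sub>\<infinity>b\<in>B. (s m b - s n b)\<^sup>2) < e / 2"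
      using Cauchy_ell2[of "e/2"] by auto
    have "norm (\<beta> * (\<Sum>\<^sub>\<infinity>b\<in>B. (s n b - u b)\<^sup>2) - 0) < e" if "n \<ge> N" for n
    proof -
      have "(\<Sum>\<^sub>\<infinity>b\<in>B. (s n b - u b)\<^sup>2) \<le> e / 2 / \<beta>"
      proof (rule tail(2))
        fix m assume "n \<le> m"
        then have "\<beta> * (\<Sum>\<^sub>\<infinity>b\<in>B. (s n b - s m b)\<^sup>2) < e / 2" using that by (intro N) auto
        then show "(\<Sum>\<^sub>\<infinity>b\<in>B. (s n b - s m b)\<^sup>2) \<le> e / 2 / \<beta>" using \<beta> by (simp add: field_simps)
      qed
      then have "\<beta> * (\<Sum>\<^sub>\<infinity>b\<in>B. (s n b - u b)\<^sup>2) \<le> e / 2" using \<beta> by (simp add: field_simps)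
      moreover have "0 \<le> \<beta> * (\<Sum>\<^sub>\<infinity>b\<in>B. (s n b - u b)\<^sup>2)"
        using \<beta> by (intro mult_nonneg_nonneg infsum_nonneg) auto
      ultimately show ?thesis using e by simp
    qed
    then show "\<exists>N. \<forall>n\<ge>N. norm (\<beta> * (\<Sum>\<^sub>\<infinity>b\<in>B. (s n b - u b)\<^sup>2) - 0) < e" by blast
  qed
  moreover have "(\<integral>x. (v n x - weak_deriv u x)\<^sup>2 \<partial>leb01) = (\<integral>x. (v n x - w x)\<^sup>2 \<partial>leb01)" for n
    using weak_deriv_primitive[OF w] L2.diff[OF v w, of n] L2.diff[OF v V_spaceD(1)[OF u], of n]
    unfolding power2_eq_square u_def by (intro L2_inner_cong_AE) auto
  ultimately have "(\<lambda>n. energy B \<beta> (\<lambda>x. s n x - u x) (\<lambda>x. s n x - u x)) \<longlonglongrightarrow> 0"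
    using tendsto_add[OF lim_w] by (simp add: energy_diff[OF s u] flip: v_def)
  then show ?thesis using u by blast
qed

section \<open>The load functional and well-posedness\<close>

definition load :: "real set \<Rightarrow> (real \<Rightarrow> real) \<Rightarrow> (real \<Rightarrow> real) \<Rightarrow> (real \<Rightarrow> real) \<Rightarrow> real" where
  "load B F f q = (\<integral>x. F x * q x \<partial>leb01) + (\<Sum>\<^sub>\<infinity>b\<in>B. f b * q b)"

lemma load_comb:
  assumes "F \<in> L2_01" "f \<in> ell2 B" and u: "u \<in> V_space B" and v: "v \<in> V_space B"
  shows "load B F f (\<lambda>x. u x + c * v x) = load B F f u + c * load B F f v"
  using L2.lin[OF V_spaceD(4)[OF u] V_spaceD(4)[OF v] assms(1), of c]
    ell2.lin[OF V_spaceD(3)[OF u] V_spaceD(3)[OF v] assms(2), of c]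
  by (simp add: load_def mult.commute distrib_left)

lemma load_diff_data:
  assumes "F \<in> L2_01" "G \<in> L2_01" "f \<in> ell2 B" "g \<in> ell2 B" and q: "q \<in> V_space B"
  shows "load B (\<lambda>x. F x - G x) (\<lambda>b. f b - g b) q = load B F f q - load B G g q"
  using L2.diff_left[OF assms(1,2) V_spaceD(4)[OF q]] ell2.diff_left[OF assms(3,4) V_spaceD(3)[OF q]]
  by (simp add: load_def)

lemma V_norm_power2:
  assumes "q \<in> V_space B"
  shows "(V_norm B q)\<^sup>2 = (L2_norm (weak_deriv q))\<^sup>2 + (ell2_norm B q)\<^sup>2"
  using L2.nonneg[OF V_spaceD(1)[OF assms]] ell2.nonneg[OF V_spaceD(3)[OF assms]]
  by (simp add: V_norm_def V_inner_def L2_norm_eq ell2_norm_eq)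

lemma L2_norm_nonneg: "0 \<le> L2_norm F" by (simp add: L2_norm_def)

text \<open>
  Point evaluations are continuous on \<open>V\<close>.  In particular a function of norm zero is zero everywhere,
  which turns the stability estimate into uniqueness.
\<close>
lemma abs_le_V_norm:
  assumes q: "q \<in> V_space B"
  shows "\<bar>q x\<bar> \<le> V_norm B q"
proof -
  have "\<bar>q x\<bar> \<le> L2_norm (weak_deriv q)"
    using primitive_bound[OF V_spaceD(1)[OF q], of x] by (simp add: V_spaceD(2)[OF q])
  also have "\<dots> \<le> V_norm B q"
    by (rule power2_le_imp_le)
      (use ell2.nonneg[OF V_spaceD(3)[OF q]] L2.nonneg[OF V_spaceD(1)[OF q]] in
        \<open>auto simp: V_norm_def V_inner_def L2_norm_eq\<close>)
  finally show ?thesis .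
qed

text \<open>A function vanishing at \<open>0\<close> is bounded by the norm of its derivative, and the interval has length one.\<close>
lemma poincare:
  assumes q: "q \<in> V_space B"
  shows "L2_norm q \<le> L2_norm (weak_deriv q)"
proof -
  have le: "\<bar>q x\<bar> \<le> L2_norm (weak_deriv q)" for x
    using primitive_bound[OF V_spaceD(1)[OF q], of x] by (simp add: V_spaceD(2)[OF q])
  have "(\<integral>x. (q x)\<^sup>2 \<partial>leb01) \<le> (\<integral>x. (L2_norm (weak_deriv q))\<^sup>2 \<partial>leb01)"
    using V_spaceD(4)[OF q] abs_le_square_iff[of "q _" "L2_norm (weak_deriv q)"] le L2_norm_nonneg
    by (intro integral_mono) (auto simp: L2_01_def)
  also have "\<dots> = (L2_norm (weak_deriv q))\<^sup>2"
    by (simp add: measure_restrict_space)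
  finally show ?thesis
    unfolding L2_norm_def[of q] using real_le_lsqrt L2_norm_nonneg by blast
qed

text \<open>Combines the separate Cauchy--Schwarz bounds of the \<open>L\<^sup>2\<close> part and the \<open>\<ell>\<^sup>2\<close> part.\<close>
lemma cauchy_schwarz_pair:
  fixes a b c d :: real
  shows "a * c + b * d \<le> sqrt (a\<^sup>2 + b\<^sup>2) * sqrt (c\<^sup>2 + d\<^sup>2)"
proof -
  have "(a * c + b * d)\<^sup>2 \<le> (a\<^sup>2 + b\<^sup>2) * (c\<^sup>2 + d\<^sup>2)"
  proof -
    have "0 \<le> (a * d - b * c)\<^sup>2" by simp
    then show ?thesis by (simp add: power2_eq_square algebra_simps)
  qed
  then show ?thesis by (metis real_le_rsqrt real_sqrt_mult)
qed

lemma load_bound: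
  assumes F: "F \<in> L2_01" and f: "f \<in> ell2 B" and q: "q \<in> V_space B"
  shows "\<bar>load B F f q\<bar> \<le> sqrt ((L2_norm F)\<^sup>2 + (ell2_norm B f)\<^sup>2) * V_norm B q"
proof -
  have "\<bar>load B F f q\<bar> \<le> L2_norm F * L2_norm q + ell2_norm B f * ell2_norm B q"
    using L2.cauchy_schwarz_sqrt[OF F V_spaceD(4)[OF q]] ell2.cauchy_schwarz_sqrt[OF f V_spaceD(3)[OF q]]
    by (simp add: load_def L2_norm_eq ell2_norm_eq)
  also have "\<dots> \<le> L2_norm F * L2_norm (weak_deriv q) + ell2_norm B f * ell2_norm B q"
    using poincare[OF q] by (intro add_right_mono mult_left_mono L2_norm_nonneg)
  also have "\<dots> \<le> sqrt ((L2_norm F)\<^sup>2 + (ell2_norm B f)\<^sup>2) * V_norm B q"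
    using cauchy_schwarz_pair[of "L2_norm F" "L2_norm (weak_deriv q)" "ell2_norm B f" "ell2_norm B q"]
      ell2.nonneg[OF V_spaceD(3)[OF q]]
    by (simp flip: V_norm_power2[OF q] add: V_norm_def V_inner_def)
  finally show ?thesis .
qed

lemma energy_coercive:
  assumes "0 < \<beta>" and q: "q \<in> V_space B"
  shows "min 1 \<beta> * (V_norm B q)\<^sup>2 \<le> energy B \<beta> q q"
proof -
  let ?D = "\<integral>x. weak_deriv q x * weak_deriv q x \<partial>leb01" and ?S = "\<Sum>\<^sub>\<infinity>b\<in>B. q b * q b"
  have "0 \<le> ?D" "0 \<le> ?S" by (rule L2.nonneg[OF V_spaceD(1)[OF q]], rule ell2.nonneg[OF V_spaceD(3)[OF q]])
  then have "min 1 \<beta> * ?D \<le> 1 * ?D" "min 1 \<beta> * ?S \<le> \<beta> * ?S" by (intro mult_right_mono; simp)+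
  then have "min 1 \<beta> * (?D + ?S) \<le> energy B \<beta> q q" by (simp add: energy_def distrib_left)
  moreover have "(V_norm B q)\<^sup>2 = ?D + ?S"
    using \<open>0 \<le> ?D\<close> \<open>0 \<le> ?S\<close> by (simp add: V_norm_def V_inner_def)
  ultimately show ?thesis by simp
qed

text \<open>
  Subtract the two equations, test with \<open>e = p' - p\<close>, and use coercivity on the left and boundedness
  of the load on the right; one factor \<open>\<parallel>e\<parallel>\<close> cancels.
\<close>
lemma stability:
  assumes \<beta>: "0 < \<beta>"
    and data: "F \<in> L2_01" "f \<in> ell2 B" "F' \<in> L2_01" "f' \<in> ell2 B"
    and p: "p \<in> V_space B" "\<And>q. q \<in> V_space B \<Longrightarrow> energy B \<beta> p q = load B F f q"
    and p': "p' \<in> V_space B" "\<And>q. q \<in> V_space B \<Longrightarrow> energy B \<beta> p' q = load B F' f' q"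
  shows "min 1 \<beta> * V_dist B p' p \<le> data_dist B (F', f') (F, f)"
proof -
  interpret E: semi_inner "V_space B" "energy B \<beta>" using \<beta> by (intro semi_inner_energy) simp
  define e where "e x = p' x - p x" for x
  have e: "e \<in> V_space B" unfolding e_def by (rule E.diff[OF p'(1) p(1)])
  define N where "N = V_norm B e"
  have N: "0 \<le> N" using abs_le_V_norm[OF e, of 0] by (simp add: N_def)
  have "min 1 \<beta> * N\<^sup>2 \<le> energy B \<beta> e e" unfolding N_def by (rule energy_coercive[OF \<beta> e])
  also have "\<dots> = energy B \<beta> p' e - energy B \<beta> p e"
    using E.diff_left[OF p'(1) p(1) e] by (simp add: e_def[abs_def])
  also have "\<dots> = load B (\<lambda>x. F' x - F x) (\<lambda>b. f' b - f b) e"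
    using p(2)[OF e] p'(2)[OF e] load_diff_data[OF data(3,1,4,2) e] by simp
  also have "\<dots> \<le> data_dist B (F', f') (F, f) * N"
    using load_bound[OF L2.diff[OF data(3,1)] ell2.diff[OF data(4,2)] e]
    by (simp add: data_dist_def N_def)
  finally have "(min 1 \<beta> * N) * N \<le> data_dist B (F', f') (F, f) * N" by (simp add: power2_eq_square)
  moreover have "0 \<le> data_dist B (F', f') (F, f)" by (simp add: data_dist_def)
  ultimately have "min 1 \<beta> * N \<le> data_dist B (F', f') (F, f)"
    using N by (cases "N = 0") auto
  then show ?thesis by (simp add: V_dist_def N_def e_def[abs_def])
qed

lemma solution_exists:
  assumes \<beta>: "0 < \<beta>" and F: "F \<in> L2_01" and f: "f \<in> ell2 B"
  shows "\<exists>p\<in>V_space B. \<forall>q\<in>V_space B. energy B \<beta> p q = load B F f q"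
proof -
  interpret E: semi_inner "V_space B" "energy B \<beta>" using \<beta> by (intro semi_inner_energy) simp
  define D where "D = sqrt ((L2_norm F)\<^sup>2 + (ell2_norm B f)\<^sup>2)"
  show ?thesis
  proof (rule E.riesz_representation)
    fix u assume u: "u \<in> V_space B"
    \<comment> \<open>The load is bounded in the norm of \<open>V\<close>; coercivity converts this to the energy norm.\<close>
    have "sqrt (min 1 \<beta>) * V_norm B u = sqrt (min 1 \<beta> * (V_norm B u)\<^sup>2)"
      using abs_le_V_norm[OF u, of 0] by (simp add: real_sqrt_mult)
    also have "\<dots> \<le> sqrt (energy B \<beta> u u)"
      by (rule real_sqrt_le_mono[OF energy_coercive[OF \<beta> u]])
    finally have "V_norm B u \<le> sqrt (energy B \<beta> u u) / sqrt (min 1 \<beta>)"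
      using \<beta> by (simp add: pos_le_divide_eq mult.commute)
    then have "D * V_norm B u \<le> D * (sqrt (energy B \<beta> u u) / sqrt (min 1 \<beta>))"
      by (intro mult_left_mono) (simp_all add: D_def)
    then show "\<bar>load B F f u\<bar> \<le> (D / sqrt (min 1 \<beta>)) * sqrt (energy B \<beta> u u)"
      using load_bound[OF F f u] by (simp add: D_def)
  qed (use energy_complete[OF \<beta>] load_comb[OF F f] in auto)
qed

theorem theorem4:
  fixes B :: "real set" and \<beta> :: real
  assumes "fractal_microstructure B" and "\<beta> > 0"
  shows "well_posed (L2_01 \<times> ell2 B) (data_dist B) (V_space B) (V_dist B)
    (\<lambda>(F, f) p. \<forall>q\<in>V_space B.
       (\<integral>x. weak_deriv p x * weak_deriv q x \<partial>leb01) + \<beta> * (\<Sum>\<^sub>\<infinity>b\<in>B. p b * q b) =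
       (\<integral>x. F x * q x \<partial>leb01) + (\<Sum>\<^sub>\<infinity>b\<in>B. f b * q b))"
  unfolding well_posed_def energy_def[symmetric] load_def[symmetric]
proof (intro conjI ballI allI impI)
  fix d assume "d \<in> L2_01 \<times> ell2 B"
  then obtain F f where d: "d = (F, f)" and data: "F \<in> L2_01" "f \<in> ell2 B" by auto
  let ?sol = "\<lambda>(F, f) p. \<forall>q\<in>V_space B. energy B \<beta> p q = load B F f q"
  have unique: "p' = p" if "p \<in> V_space B" "?sol (F, f) p" "p' \<in> V_space B" "?sol (F, f) p'" for p p'
  proof
    fix x
    interpret E: semi_inner "V_space B" "energy B \<beta>" using assms(2) by (intro semi_inner_energy) simp
    have "min 1 \<beta> * V_dist B p' p \<le> data_dist B (F, f) (F, f)"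
      using that by (intro stability assms data) auto
    also have "\<dots> = 0" by (simp add: data_dist_def L2_norm_def ell2_norm_def)
    finally have "V_dist B p' p \<le> 0" using assms(2) by (auto simp: mult_le_0_iff min_le_iff_disj)
    then show "p' x = p x" using abs_le_V_norm[OF E.diff[OF that(3,1)], of x] by (simp add: V_dist_def)
  qed
  show "\<exists>!u. u \<in> V_space B \<and> ?sol d u"
    using solution_exists[OF assms(2) data] unique unfolding d by blast
  fix u \<epsilon> assume u: "u \<in> V_space B" "?sol d u" and \<epsilon>: "(0::real) < \<epsilon>"
  show "\<exists>\<delta>>0. \<forall>d'\<in>L2_01 \<times> ell2 B. \<forall>u'\<in>V_space B.
      ?sol d' u' \<and> data_dist B d' d < \<delta> \<longrightarrow> V_dist B u' u < \<epsilon>"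
  proof (intro exI[of _ "min 1 \<beta> * \<epsilon>"] conjI ballI impI)
    show "0 < min 1 \<beta> * \<epsilon>" using \<epsilon> assms(2) by simp
    fix d' u' assume "d' \<in> L2_01 \<times> ell2 B" and u': "u' \<in> V_space B"
      and "?sol d' u' \<and> data_dist B d' d < min 1 \<beta> * \<epsilon>"
    moreover from this obtain F' f' where d': "d' = (F', f')" by (cases d')
    ultimately have "min 1 \<beta> * V_dist B u' u < min 1 \<beta> * \<epsilon>"
      using stability[OF assms(2) data, of F' f' u u'] u unfolding d by force
    then show "V_dist B u' u < \<epsilon>" using assms(2) by (simp add: mult_less_cancel_left_pos)
  qed
qed

end
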